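(* Let $(M,g)$ be a smooth $n$-dimensional Riemannian manifold, and let its tangent bundle $TM$ be endowed with the Sasaki metric $g^s$. Then the horizontal distribution $HTM$ and the vertical distribution $VTM$ are both isocline distributions on the Riemannian manifold $(TM,g^s)$.
   Context: Let $\tau:TM\to M$ be the tangent bundle of $(M,g)$ and $\nabla$ the Levi-Civita connection of $g$. One has $TTM=VTM\oplus HTM$, where $VTM=\ker\tau_*$ is the vertical distribution and $HTM$ is the horizontal distribution defined by $\nabla$. In induced local coordinates $(x^1,\dots,x^n,y^1,\dots,y^n)$ on $TM$ (where $y^i$ are the components of a tangent vector $y^i\frac{\partial}{\partial x^i}$), $VTM$ is spanned by $\frac{\partial}{\partial y^i}$ and $HTM$ is spanned by $\frac{\delta}{\delta x^j}=\frac{\partial}{\partial x^j}-y^k\Gamma^h_{kj}\frac{\partial}{\partial y^h}$, with $\Gamma^h_{kj}$ the Christoffel symbols of $g$. For a vector field $X=X^i\frac{\partial}{\partial x^i}$ on $M$, its vertical and horizontal lifts are $X^V=X^i\frac{\partial}{\partial y^i}$ and $X^H=X^i\frac{\delta}{\delta x^i}$. The Sasaki metric $g^s$ on $TM$ is defined by $g^s(X^H,Y^H)=g^s(X^V,Y^V)=g(X,Y)\circ\tau$ and $g^s(X^H,Y^V)=g^s(X^V,Y^H)=0$ for all vector fields $X,Y$ on $M$. A (regular) distribution $F$ on a Riemannian manifold is called totally geodesic if every geodesic which is tangent to $F$ at one point is tangent to $F$ at all of its points. A totally geodesic distribution $F$ is called isocline if for every geodesic $\gamma$ parametrized by arc length,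 the angle between $F$ and the tangent vector $\dot\gamma(s)$ (i.e. the angle between $\dot\gamma(s)$ and the subspace $F_{\gamma(s)}$) is constant along $\gamma$. In particular, isocline includes totally geodesic. *)

theory Defs
  imports "HOL-Analysis.Analysis"
begin

section \<open>Smooth maps between Euclidean spaces\<close>

text \<open>Both notions are meant for an open set \<open>S\<close> only.\<close>

primrec Ck_on :: "nat \<Rightarrow> 'a::real_normed_vector set \<Rightarrow> ('a \<Rightarrow> 'b::real_normed_vector) \<Rightarrow> bool" where
  "Ck_on 0 S f \<longleftrightarrow> continuous_on S f"
| "Ck_on (Suc k) S f \<longleftrightarrow>
     (\<forall>x\<in>S. f differentiable (at x)) \<and> (\<forall>v. Ck_on k S (\<lambda>x. frechet_derivative f (at x) v))"

definition smooth_on :: "'a::real_normed_vector set \<Rightarrow> ('a \<Rightarrow> 'b::real_normed_vector) \<Rightarrow> bool" where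
  "smooth_on S f \<longleftrightarrow> (\<forall>k. Ck_on k S f)"

section \<open>Smooth manifolds and their tangent vectors\<close>

text \<open>A chart is a pair of its domain \<open>U\<close> and a coordinate map, of which only the values on \<open>U\<close>
  matter.  A manifold modelled on the Euclidean space \<open>'e\<close> (of dimension \<open>DIM('e)\<close>) is given by an
  atlas alone: its point set is the union of the chart domains, and its topology is the one for which
  all charts are homeomorphisms onto open sets.\<close>

type_synonym ('m, 'e) chart = "'m set \<times> ('m \<Rightarrow> 'e)"

definition carrier_of :: "('m, 'e) chart set \<Rightarrow> 'm set" where
  "carrier_of A = (\<Union>c\<in>A. fst c)"

abbreviation chart_image :: "('m, 'e) chart \<Rightarrow> 'e set" where
  "chart_image c \<equiv> snd c ` fst c"

definition chart_inv :: "('m, 'e) chart \<Rightarrow> 'e \<Rightarrow> 'm" where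
  "chart_inv c = inv_into (fst c) (snd c)"

definition transition :: "('m, 'e) chart \<Rightarrow> ('m, 'e) chart \<Rightarrow> 'e \<Rightarrow> 'e" where
  "transition c c' = snd c' \<circ> chart_inv c"

definition atlas_topology :: "('m, 'e::euclidean_space) chart set \<Rightarrow> 'm topology" where
  "atlas_topology A =
     topology (\<lambda>W. W \<subseteq> carrier_of A \<and> (\<forall>c\<in>A. open (snd c ` (W \<inter> fst c))))"

definition smooth_manifold :: "('m, 'e::euclidean_space) chart set \<Rightarrow> bool" where
  "smooth_manifold A \<longleftrightarrow>
     (\<forall>c\<in>A. inj_on (snd c) (fst c)) \<and>
     (\<forall>c\<in>A. \<forall>c'\<in>A. open (snd c ` (fst c \<inter> fst c')) \<and>
        smooth_on (snd c ` (fst c \<inter> fst c')) (transition c c')) \<and>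
     Hausdorff_space (atlas_topology A) \<and>
     second_countable (atlas_topology A)"

text \<open>A tangent vector at \<open>p\<close> is the family of its components in all charts around \<open>p\<close>, subject to
  the usual transformation rule; it has the dummy value \<open>0\<close> at the other arguments.  The vector
  operations are pointwise.\<close>

type_synonym ('m, 'e) tvec = "('m, 'e) chart \<Rightarrow> 'e"

definition tangent_space ::
    "('m, 'e::euclidean_space) chart set \<Rightarrow> 'm \<Rightarrow> ('m, 'e) tvec set" where
  "tangent_space A p =
     {v. (\<forall>c\<in>A. \<forall>c'\<in>A. p \<in> fst c \<longrightarrow> p \<in> fst c' \<longrightarrow>
            v c' = frechet_derivative (transition c c') (at (snd c p)) (v c)) \<and>
         (\<forall>c. \<not> (c \<in> A \<and> p \<in> fst c) \<longrightarrow> v c = 0)}"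

text \<open>The tangent vector \<open>\<Sum>i. u\<^sup>i \<partial>/\<partial>x\<^sup>i\<close> at \<open>p\<close>, where \<open>x\<close> are the coordinates of the chart \<open>c\<close>.\<close>

definition coord_vec ::
    "('m, 'e::euclidean_space) chart set \<Rightarrow> 'm \<Rightarrow> ('m, 'e) chart \<Rightarrow> 'e \<Rightarrow> ('m, 'e) tvec" where
  "coord_vec A p c u =
     (\<lambda>c'. if c' \<in> A \<and> p \<in> fst c' then frechet_derivative (transition c c') (at (snd c p)) u else 0)"

definition chart_at :: "('m, 'e) chart set \<Rightarrow> 'm \<Rightarrow> ('m, 'e) chart" where
  "chart_at A p = (SOME c. c \<in> A \<and> p \<in> fst c)"

definition differential ::
    "('m, 'e::euclidean_space) chart set \<Rightarrow> ('k, 'f::euclidean_space) chart set \<Rightarrow> ('m \<Rightarrow> 'k) \<Rightarrow>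
     'm \<Rightarrow> ('m, 'e) tvec \<Rightarrow> ('k, 'f) tvec" where
  "differential A B f p \<xi> =
     (let c = chart_at A p in
      (\<lambda>c'. if c' \<in> B \<and> f p \<in> fst c'
            then frechet_derivative (snd c' \<circ> f \<circ> chart_inv c) (at (snd c p)) (\<xi> c) else 0))"

section \<open>Riemannian metrics and geodesics\<close>

type_synonym ('m, 'e) metric_field = "'m \<Rightarrow> ('m, 'e) tvec \<Rightarrow> ('m, 'e) tvec \<Rightarrow> real"

text \<open>For the standard basis, \<open>local_metric A g c x e\<^sub>i e\<^sub>j\<close> is the component \<open>g\<^sub>i\<^sub>j\<close> in the chart \<open>c\<close>
  at the point with coordinates \<open>x\<close>.\<close>

definition local_metric ::
    "('m, 'e::euclidean_space) chart set \<Rightarrow> ('m, 'e) metric_field \<Rightarrow> ('m, 'e) chart \<Rightarrow>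
     'e \<Rightarrow> 'e \<Rightarrow> 'e \<Rightarrow> real" where
  "local_metric A g c x u v =
     (let p = chart_inv c x in g p (coord_vec A p c u) (coord_vec A p c v))"

definition riemannian_metric ::
    "('m, 'e::euclidean_space) chart set \<Rightarrow> ('m, 'e) metric_field \<Rightarrow> bool" where
  "riemannian_metric A g \<longleftrightarrow>
     (\<forall>c\<in>A.
        (\<forall>u v. smooth_on (chart_image c) (\<lambda>x. local_metric A g c x u v)) \<and>
        (\<forall>x\<in>chart_image c.
           bilinear (local_metric A g c x) \<and>
           (\<forall>u v. local_metric A g c x u v = local_metric A g c x v u) \<and>
           (\<forall>u. u \<noteq> 0 \<longrightarrow> local_metric A g c x u u > 0)))"

definition riemannian_manifold ::
    "('m, 'e::euclidean_space) chart set \<Rightarrow> ('m, 'e) metric_field \<Rightarrow> bool" where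
  "riemannian_manifold A g \<longleftrightarrow> smooth_manifold A \<and> riemannian_metric A g"

text \<open>The Christoffel symbols of the Levi-Civita connection in the chart \<open>c\<close>, as the bilinear map
  sending \<open>u, v\<close> to the vector with components \<open>\<Gamma>\<^sup>h\<^sub>k\<^sub>j u\<^sup>k v\<^sup>j\<close>.  The defining equation is
  \<open>g\<^sub>h\<^sub>l \<Gamma>\<^sup>h\<^sub>k\<^sub>j = 1/2 (\<partial>\<^sub>k g\<^sub>j\<^sub>l + \<partial>\<^sub>j g\<^sub>k\<^sub>l - \<partial>\<^sub>l g\<^sub>k\<^sub>j)\<close>, contracted with \<open>u\<^sup>k\<close>, \<open>v\<^sup>j\<close> and an arbitrary \<open>w\<^sup>l\<close>.\<close>

definition christoffel ::
    "('m, 'e::euclidean_space) chart set \<Rightarrow> ('m, 'e) metric_field \<Rightarrow> ('m, 'e) chart \<Rightarrow>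
     'e \<Rightarrow> 'e \<Rightarrow> 'e \<Rightarrow> 'e" where
  "christoffel A g c x u v =
     (THE z. \<forall>w. local_metric A g c x z w =
        (frechet_derivative (\<lambda>x. local_metric A g c x v w) (at x) u +
         frechet_derivative (\<lambda>x. local_metric A g c x u w) (at x) v -
         frechet_derivative (\<lambda>x. local_metric A g c x u v) (at x) w) / 2)"

definition smooth_curve ::
    "('m, 'e::euclidean_space) chart set \<Rightarrow> real set \<Rightarrow> (real \<Rightarrow> 'm) \<Rightarrow> bool" where
  "smooth_curve A I \<gamma> \<longleftrightarrow>
     \<gamma> ` I \<subseteq> carrier_of A \<and>
     (\<forall>c\<in>A. open {s \<in> I. \<gamma> s \<in> fst c} \<and> smooth_on {s \<in> I. \<gamma> s \<in> fst c} (snd c \<circ> \<gamma>))"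

definition velocity ::
    "('m, 'e::euclidean_space) chart set \<Rightarrow> (real \<Rightarrow> 'm) \<Rightarrow> real \<Rightarrow> ('m, 'e) tvec" where
  "velocity A \<gamma> s =
     (\<lambda>c. if c \<in> A \<and> \<gamma> s \<in> fst c then vector_derivative (snd c \<circ> \<gamma>) (at s) else 0)"

text \<open>A geodesic is a smooth curve on an open interval with \<open>\<nabla>\<^bsub>\<gamma>'\<^esub> \<gamma>' = 0\<close>.\<close>

definition geodesic ::
    "('m, 'e::euclidean_space) chart set \<Rightarrow> ('m, 'e) metric_field \<Rightarrow> real set \<Rightarrow>
     (real \<Rightarrow> 'm) \<Rightarrow> bool" where
  "geodesic A g I \<gamma> \<longleftrightarrow>
     open I \<and> is_interval I \<and> smooth_curve A I \<gamma> \<and>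
     (\<forall>c\<in>A. \<forall>s\<in>I. \<gamma> s \<in> fst c \<longrightarrow>
        (let x = snd c \<circ> \<gamma>; x' = (\<lambda>t. vector_derivative x (at t)) in
         vector_derivative x' (at s) + christoffel A g c (x s) (x' s) (x' s) = 0))"

definition arc_length_param ::
    "('m, 'e::euclidean_space) chart set \<Rightarrow> ('m, 'e) metric_field \<Rightarrow> real set \<Rightarrow>
     (real \<Rightarrow> 'm) \<Rightarrow> bool" where
  "arc_length_param A g I \<gamma> \<longleftrightarrow>
     (\<forall>s\<in>I. sqrt (g (\<gamma> s) (velocity A \<gamma> s) (velocity A \<gamma> s)) = 1)"

section \<open>Isocline distributions\<close>

text \<open>A regular distribution: a family of tangent subspaces of constant dimension \<open>k\<close> that is
  locally spanned by \<open>k\<close> smooth vector fields, here written in coordinates.\<close>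

definition regular_distribution ::
    "('m, 'e::euclidean_space) chart set \<Rightarrow> ('m \<Rightarrow> ('m, 'e) tvec set) \<Rightarrow> bool" where
  "regular_distribution A F \<longleftrightarrow>
     (\<forall>p\<in>carrier_of A. F p \<subseteq> tangent_space A p) \<and>
     (\<exists>k::nat. \<forall>c\<in>A. \<forall>p\<in>fst c. \<exists>W X.
        open W \<and> snd c p \<in> W \<and> W \<subseteq> chart_image c \<and>
        (\<forall>i<k. smooth_on W (X i)) \<and>
        (\<forall>x\<in>W. (\<lambda>\<xi>. \<xi> c) ` F (chart_inv c x) = span ((\<lambda>i. X i x) ` {..<k}) \<and>
               dim ((\<lambda>i. X i x) ` {..<k}) = k))"

definition vec_angle ::
    "('m, 'e) metric_field \<Rightarrow> 'm \<Rightarrow> ('m, 'e) tvec \<Rightarrow> ('m, 'e) tvec \<Rightarrow> real" where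
  "vec_angle g p v w = arccos (g p v w / (sqrt (g p v v) * sqrt (g p w w)))"

text \<open>The angle between a nonzero vector and a nontrivial subspace is the least angle between the
  vector and the nonzero vectors of the subspace; it lies between \<open>0\<close> and \<open>\<pi>/2\<close>.\<close>

definition subspace_angle ::
    "('m, 'e::euclidean_space) metric_field \<Rightarrow> 'm \<Rightarrow> ('m, 'e) tvec \<Rightarrow> ('m, 'e) tvec set \<Rightarrow> real" where
  "subspace_angle g p v S = Inf (vec_angle g p v ` (S - {\<lambda>_. 0}))"

definition totally_geodesic ::
    "('m, 'e::euclidean_space) chart set \<Rightarrow> ('m, 'e) metric_field \<Rightarrow>
     ('m \<Rightarrow> ('m, 'e) tvec set) \<Rightarrow> bool" where
  "totally_geodesic A g F \<longleftrightarrow>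
     regular_distribution A F \<and>
     (\<forall>I \<gamma>. geodesic A g I \<gamma> \<longrightarrow> (\<exists>s\<in>I. velocity A \<gamma> s \<in> F (\<gamma> s)) \<longrightarrow>
        (\<forall>s\<in>I. velocity A \<gamma> s \<in> F (\<gamma> s)))"

definition isocline ::
    "('m, 'e::euclidean_space) chart set \<Rightarrow> ('m, 'e) metric_field \<Rightarrow>
     ('m \<Rightarrow> ('m, 'e) tvec set) \<Rightarrow> bool" where
  "isocline A g F \<longleftrightarrow>
     totally_geodesic A g F \<and>
     (\<forall>I \<gamma>. geodesic A g I \<gamma> \<longrightarrow> arc_length_param A g I \<gamma> \<longrightarrow>
        (\<exists>\<theta>. \<forall>s\<in>I. subspace_angle g (\<gamma> s) (velocity A \<gamma> s) (F (\<gamma> s)) = \<theta>))"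

section \<open>The tangent bundle and its Sasaki metric\<close>

text \<open>Points of \<open>TM\<close> are pairs \<open>(p, v)\<close> with \<open>v\<close> tangent at \<open>p\<close>, and the bundle projection \<open>\<tau>\<close> is
  \<open>fst\<close>.  The chart of \<open>TM\<close> induced by a chart \<open>c\<close> of \<open>M\<close> has the coordinates
  \<open>(x\<^sup>1, \<dots>, x\<^sup>n, y\<^sup>1, \<dots>, y\<^sup>n)\<close>, grouped as a pair in \<open>'e \<times> 'e\<close>.\<close>

type_synonym ('m, 'e) tpoint = "'m \<times> ('m, 'e) tvec"

definition tangent_chart ::
    "('m, 'e::euclidean_space) chart set \<Rightarrow> ('m, 'e) chart \<Rightarrow> (('m, 'e) tpoint, 'e \<times> 'e) chart" where
  "tangent_chart A c =
     ({(p, v). p \<in> fst c \<and> v \<in> tangent_space A p}, \<lambda>(p, v). (snd c p, v c))"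

definition tangent_atlas ::
    "('m, 'e::euclidean_space) chart set \<Rightarrow> (('m, 'e) tpoint, 'e \<times> 'e) chart set" where
  "tangent_atlas A = tangent_chart A ` A"

text \<open>The lifts to \<open>q = (p, v)\<close> of a tangent vector \<open>X\<close> at \<open>p\<close>: \<open>X\<^sup>V = X\<^sup>i \<partial>/\<partial>y\<^sup>i\<close> and
  \<open>X\<^sup>H = X\<^sup>j (\<partial>/\<partial>x\<^sup>j - y\<^sup>k \<Gamma>\<^sup>h\<^sub>k\<^sub>j \<partial>/\<partial>y\<^sup>h)\<close>.  The lift of a vector field at \<open>q\<close> depends only on its
  value at \<open>p\<close>, and neither lift depends on the chart used.\<close>

definition vertical_lift ::
    "('m, 'e::euclidean_space) chart set \<Rightarrow> ('m, 'e) tpoint \<Rightarrow> ('m, 'e) tvec \<Rightarrow>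
     (('m, 'e) tpoint, 'e \<times> 'e) tvec" where
  "vertical_lift A q X =
     (let c = chart_at A (fst q) in coord_vec (tangent_atlas A) q (tangent_chart A c) (0, X c))"

definition horizontal_lift ::
    "('m, 'e::euclidean_space) chart set \<Rightarrow> ('m, 'e) metric_field \<Rightarrow> ('m, 'e) tpoint \<Rightarrow>
     ('m, 'e) tvec \<Rightarrow> (('m, 'e) tpoint, 'e \<times> 'e) tvec" where
  "horizontal_lift A g q X =
     (let c = chart_at A (fst q) in
      coord_vec (tangent_atlas A) q (tangent_chart A c)
        (X c, - christoffel A g c (snd c (fst q)) (snd q c) (X c)))"

definition VTM ::
    "('m, 'e::euclidean_space) chart set \<Rightarrow> ('m, 'e) tpoint \<Rightarrow>
     (('m, 'e) tpoint, 'e \<times> 'e) tvec set" where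
  "VTM A q =
     {\<xi> \<in> tangent_space (tangent_atlas A) q. differential (tangent_atlas A) A fst q \<xi> = (\<lambda>_. 0)}"

definition HTM ::
    "('m, 'e::euclidean_space) chart set \<Rightarrow> ('m, 'e) metric_field \<Rightarrow> ('m, 'e) tpoint \<Rightarrow>
     (('m, 'e) tpoint, 'e \<times> 'e) tvec set" where
  "HTM A g q = horizontal_lift A g q ` tangent_space A (fst q)"

text \<open>Since \<open>TTM = VTM \<oplus> HTM\<close>, every \<open>\<xi>\<close> tangent to \<open>TM\<close> at \<open>q\<close> is \<open>X\<^sup>H + Y\<^sup>V\<close> for a unique pair
  \<open>(X, Y)\<close> of tangent vectors at \<open>\<tau> q\<close>.\<close>

definition lift_components ::
    "('m, 'e::euclidean_space) chart set \<Rightarrow> ('m, 'e) metric_field \<Rightarrow> ('m, 'e) tpoint \<Rightarrow>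
     (('m, 'e) tpoint, 'e \<times> 'e) tvec \<Rightarrow> ('m, 'e) tvec \<times> ('m, 'e) tvec" where
  "lift_components A g q \<xi> =
     (THE (X, Y). X \<in> tangent_space A (fst q) \<and> Y \<in> tangent_space A (fst q) \<and>
        \<xi> = (\<lambda>C. horizontal_lift A g q X C + vertical_lift A q Y C))"

text \<open>The bilinear form determined by \<open>g\<^sup>s(X\<^sup>H, Y\<^sup>H) = g\<^sup>s(X\<^sup>V, Y\<^sup>V) = g(X, Y)\<close> and
  \<open>g\<^sup>s(X\<^sup>H, Y\<^sup>V) = g\<^sup>s(X\<^sup>V, Y\<^sup>H) = 0\<close>.\<close>

definition sasaki_metric ::
    "('m, 'e::euclidean_space) chart set \<Rightarrow> ('m, 'e) metric_field \<Rightarrow>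
     (('m, 'e) tpoint, 'e \<times> 'e) metric_field" where
  "sasaki_metric A g q \<xi> \<eta> =
     (case (lift_components A g q \<xi>, lift_components A g q \<eta>) of
        ((X\<^sub>1, Y\<^sub>1), (X\<^sub>2, Y\<^sub>2)) \<Rightarrow> g (fst q) X\<^sub>1 X\<^sub>2 + g (fst q) Y\<^sub>1 Y\<^sub>2)"

end

theory Submission
  imports Defs
begin

text \<open>Write a curve in \<open>TM\<close> in induced coordinates as \<open>(x, y)\<close>, and let
  \<open>Y = y' + \<Gamma>(y, x')\<close> be the vertical part of its velocity.  The Lagrangian of the Sasaki metric is
  \<open>g(x', x') + g(Y, Y)\<close>, and its Euler-Lagrange equations in the fibre directions read
  \<open>d/dt g(Y, w) = g(Y, \<Gamma>(w, x'))\<close> for constant \<open>w\<close>; this involves no curvature.  Since \<open>\<nabla>\<close> is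
  metric, it follows that \<open>g(Y, Y)\<close> is constant along a geodesic, and so is \<open>g(x', x')\<close> by
  conservation of energy.  The velocity is horizontal if \<open>g(Y, Y) = 0\<close> and vertical if
  \<open>g(x', x') = 0\<close>, and for unit speed its angles with \<open>HTM\<close> and \<open>VTM\<close> are the arc cosines of the
  norms of its two orthogonal projections.\<close>

section \<open>Calculus of smooth maps\<close>

text \<open>The Euler-Lagrange equations in the base directions would bring in curvature;
  conservation of energy takes their place, so the Sasaki coefficients are differentiated explicitly
  along the fibres only. The fibre identity holds for constant \<open>w\<close> and is exploited by
  letting \<open>w\<close> be the value of Y at the instant considered. The obstacle is that the
  lifts and the differential of the projection are defined through arbitrarily chosen charts, and
  the Sasaki metric through a definite description on top of them. Nothing can be computed in a
  given chart before independence of the chart is known. This rests on the transformation law of the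
  Christoffel symbols, whose inhomogeneous term is the Hessian of the transition map; hence the
  symmetry of second derivatives and the calculus of families of linear maps. Regularity of
  \<open>HTM\<close> also asks for smooth Christoffel symbols, which Cramer's rule provides on
  \<open>real ^ 'n\<close>.\<close>

lemma has_derivative_eventually_in_open:
  assumes "(f has_derivative f') (at x)" "open S" "f x \<in> S"
  shows "\<forall>\<^sub>F y in nhds x. f y \<in> S"
proof -
  have "(f \<longlongrightarrow> f x) (nhds x)"
    using has_derivative_continuous[OF assms(1)] by (simp add: isCont_def tendsto_nhds_iff)
  then show ?thesis using assms(2,3) by (rule topological_tendstoD)
qed

lemma Ck_on_SucD:
  assumes "Ck_on (Suc k) S f"
  shows "\<And>x. x \<in> S \<Longrightarrow> (f has_derivative frechet_derivative f (at x)) (at x)"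
    and "\<And>v. Ck_on k S (\<lambda>x. frechet_derivative f (at x) v)"
  using assms by (simp_all flip: frechet_derivative_works)

lemma has_derivative_cong_open:
  assumes "open S" "x \<in> S" "\<And>y. y \<in> S \<Longrightarrow> f y = g y"
  shows "(f has_derivative f') (at x) \<longleftrightarrow> (g has_derivative f') (at x)"
  using has_derivative_transform_within_open[OF _ assms(1,2), of f f' UNIV g]
    has_derivative_transform_within_open[OF _ assms(1,2), of g f' UNIV f] assms(3) by auto

lemma frechet_derivative_cong_open:
  assumes "open S" "x \<in> S" "\<And>y. y \<in> S \<Longrightarrow> f y = g y"
  shows "frechet_derivative f (at x) = frechet_derivative g (at x)"
  by (simp add: frechet_derivative_def has_derivative_cong_open[OF assms])

text \<open>A derivative at a point of an open set sees only values on that set, so agreement on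
  \<open>S\<close> passes to all iterated derivatives. Both functions are generalized because the
  induction replaces them by their derivatives.\<close>

lemma Ck_on_cong:
  assumes "open S" "\<And>x. x \<in> S \<Longrightarrow> f x = g x"
  shows "Ck_on k S f \<longleftrightarrow> Ck_on k S g"
  using assms(2)
proof (induction k arbitrary: f g)
  case 0
  then show ?case by (simp cong: continuous_on_cong)
next
  case (Suc k)
  have D: "f differentiable (at x) \<longleftrightarrow> g differentiable (at x)"
    "frechet_derivative f (at x) = frechet_derivative g (at x)" if "x \<in> S" for x
    using has_derivative_cong_open[OF \<open>open S\<close> that Suc.prems]
      frechet_derivative_cong_open[OF \<open>open S\<close> that Suc.prems] by (auto simp: differentiable_def)
  have "Ck_on k S (\<lambda>x. frechet_derivative f (at x) v) \<longleftrightarrow>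
        Ck_on k S (\<lambda>x. frechet_derivative g (at x) v)" for v
    by (rule Suc.IH) (simp add: D)
  then show ?case by (simp add: D)
qed

text \<open>Frees the closure proofs from \<open>frechet_derivative\<close>: by uniqueness any
  exhibited derivative may take its place.\<close>

lemma Ck_on_SucI:
  assumes "open S" "\<And>x. x \<in> S \<Longrightarrow> (f has_derivative f' x) (at x)"
    and "\<And>v. Ck_on k S (\<lambda>x. f' x v)"
  shows "Ck_on (Suc k) S f"
proof -
  have *: "frechet_derivative f (at x) = f' x" if "x \<in> S" for x
    using frechet_derivative_at[OF assms(2)[OF that]] by simp
  show ?thesis
    using assms by (auto simp: differentiable_def * cong: Ck_on_cong)
qed

lemma Ck_on_Suc_imp: "Ck_on (Suc k) S f \<Longrightarrow> Ck_on k S f"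
proof (induction k arbitrary: f)
  case 0
  then show ?case
    by (auto intro!: continuous_at_imp_continuous_on differentiable_imp_continuous_within)
next
  case (Suc k)
  then show ?case by auto
qed

section \<open>Closure properties of maps of class k\<close>

lemma Ck_on_const:
  assumes "open S"
  shows "Ck_on k S (\<lambda>x. c)"
proof (induction k arbitrary: c)
  case (Suc k)
  show ?case
    by (rule Ck_on_SucI[OF assms]) (auto intro: derivative_intros Suc)
qed simp

lemma Ck_on_bounded_linear:
  assumes "open S" "bounded_linear L"
  shows "Ck_on k S L"
proof (cases k)
  case 0
  then show ?thesis using assms by (simp add: linear_continuous_on)
next
  case (Suc k)
  show ?thesis unfolding Suc
    by (rule Ck_on_SucI[OF assms(1)])
      (auto intro: bounded_linear_imp_has_derivative assms Ck_on_const)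
qed

lemma Ck_on_compose_linear:
  assumes "open S" "bounded_linear L" "Ck_on k S f"
  shows "Ck_on k S (\<lambda>x. L (f x))"
  using assms(3)
proof (induction k arbitrary: f)
  case 0
  then show ?case
    by (simp add: bounded_linear.continuous_on[OF assms(2)])
next
  case (Suc k)
  show ?case
    by (rule Ck_on_SucI[OF assms(1) bounded_linear.has_derivative[OF assms(2) Ck_on_SucD(1)]])
      (use Suc in \<open>auto\<close>)
qed

text \<open>For linear \<open>L\<close> the derivative in direction \<open>v\<close> is again a
  composition with \<open>L\<close>, namely of the derivative of \<open>f\<close> in the fixed
  direction \<open>L v\<close>, so the induction closes on itself. It serves to pull coefficients on
  \<open>M\<close> back along the projection of coordinates.\<close>

lemma Ck_on_linear_compose:
  assumes "open S" "bounded_linear L" "L ` S \<subseteq> T" "Ck_on k T f"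
  shows "Ck_on k S (\<lambda>x. f (L x))"
  using assms(4)
proof (induction k arbitrary: f)
  case 0
  then show ?case
    using continuous_on_compose2[of T f S L] assms by (auto simp: linear_continuous_on)
next
  case (Suc k)
  have "((\<lambda>x. f (L x)) has_derivative (\<lambda>v. frechet_derivative f (at (L x)) (L v))) (at x)"
    if "x \<in> S" for x
    using has_derivative_compose[OF bounded_linear_imp_has_derivative[OF assms(2)]
        Ck_on_SucD(1)[OF Suc.prems]] that assms(3) by blast
  then show ?case
    by (rule Ck_on_SucI[OF assms(1)]) (use Suc in auto)
qed

lemma Ck_on_add:
  assumes "open S" "Ck_on k S f" "Ck_on k S g"
  shows "Ck_on k S (\<lambda>x. f x + g x)"
  using assms(2,3)
proof (induction k arbitrary: f g)
  case 0
  then show ?case by (simp add: continuous_on_add)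
next
  case (Suc k)
  show ?case
    by (rule Ck_on_SucI[OF assms(1) has_derivative_add])
      (use Suc Ck_on_SucD(1)[OF Suc.prems(1)] Ck_on_SucD(1)[OF Suc.prems(2)] in auto)
qed

lemma Ck_on_sum:
  assumes "open S" "\<And>i. i \<in> I \<Longrightarrow> Ck_on k S (f i)"
  shows "Ck_on k S (\<lambda>x. \<Sum>i\<in>I. f i x)"
  using assms(2)
  by (induction I rule: infinite_finite_induct) (auto intro: Ck_on_const Ck_on_add assms(1))

text \<open>Each term of the product rule pairs a differentiated factor with an untouched one. The
  latter is lowered to order \<open>k\<close> by \<open>Ck_on_Suc_imp\<close>, and the induction
  hypothesis, general in both factors, covers both terms.\<close>

lemma Ck_on_bounded_bilinear:
  assumes "open S" "bounded_bilinear B" "Ck_on k S f" "Ck_on k S g"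
  shows "Ck_on k S (\<lambda>x. B (f x) (g x))"
  using assms(3,4)
proof (induction k arbitrary: f g)
  case 0
  then show ?case by (simp add: bounded_bilinear.continuous_on[OF assms(2)])
next
  case (Suc k)
  show ?case
    by (rule Ck_on_SucI[OF assms(1) bounded_bilinear.FDERIV[OF assms(2)]],
        erule Ck_on_SucD(1)[OF Suc.prems(1)], erule Ck_on_SucD(1)[OF Suc.prems(2)])
      (intro Ck_on_add assms Suc.IH Ck_on_Suc_imp[OF Suc.prems(1)] Ck_on_Suc_imp[OF Suc.prems(2)]
        Ck_on_SucD(2)[OF Suc.prems(1)] Ck_on_SucD(2)[OF Suc.prems(2)])
qed

lemma Ck_on_prod:
  fixes f :: "'i \<Rightarrow> 'a::real_normed_vector \<Rightarrow> real"
  assumes "open S" "\<And>i. i \<in> I \<Longrightarrow> Ck_on k S (f i)"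
  shows "Ck_on k S (\<lambda>x. \<Prod>i\<in>I. f i x)"
  using assms(2)
  by (induction I rule: infinite_finite_induct)
    (auto intro: Ck_on_const Ck_on_bounded_bilinear[OF assms(1) bounded_bilinear_mult] assms(1))

text \<open>The derivative of 1/f is built from the derivative of \<open>f\<close> and 1/f itself,
  so the induction keeps \<open>f\<close> fixed and feeds on the regularity of 1/f one order
  below.\<close>

lemma Ck_on_inverse:
  fixes f :: "'a::real_normed_vector \<Rightarrow> real"
  assumes "open S" "\<And>x. x \<in> S \<Longrightarrow> f x \<noteq> 0" "Ck_on k S f"
  shows "Ck_on k S (\<lambda>x. inverse (f x))"
  using assms(3)
proof (induction k)
  case 0
  then show ?case using assms by (auto intro: continuous_on_inverse)
next
  case (Suc k)
  have I: "Ck_on k S (\<lambda>x. inverse (f x))"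
    by (rule Suc.IH[OF Ck_on_Suc_imp[OF Suc.prems]])
  show ?case
  proof (rule Ck_on_SucI[OF assms(1)])
    show "((\<lambda>x. inverse (f x)) has_derivative
        (\<lambda>h. - (inverse (f x) * frechet_derivative f (at x) h * inverse (f x)))) (at x)"
      if "x \<in> S" for x
      by (rule Deriv.has_derivative_inverse[OF assms(2)[OF that] Ck_on_SucD(1)[OF Suc.prems that]])
    show "Ck_on k S (\<lambda>x. - (inverse (f x) * frechet_derivative f (at x) v * inverse (f x)))" for v
      by (intro Ck_on_compose_linear[OF assms(1) bounded_linear_minus[OF bounded_linear_ident]]
          Ck_on_bounded_bilinear[OF assms(1) bounded_bilinear_mult] I Ck_on_SucD(2)[OF Suc.prems])
  qed
qed

section \<open>Closure properties of smooth maps\<close>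

lemma smooth_on_Ck: "smooth_on S f \<Longrightarrow> Ck_on k S f"
  by (simp add: smooth_on_def)

lemma smooth_on_has_derivative:
  "smooth_on S f \<Longrightarrow> x \<in> S \<Longrightarrow> (f has_derivative frechet_derivative f (at x)) (at x)"
  by (rule Ck_on_SucD(1)[OF smooth_on_Ck])

lemma smooth_on_frechet_derivative:
  "smooth_on S f \<Longrightarrow> smooth_on S (\<lambda>x. frechet_derivative f (at x) v)"
  unfolding smooth_on_def by (metis Ck_on_SucD(2))

lemma smooth_on_cong:
  "open S \<Longrightarrow> (\<And>x. x \<in> S \<Longrightarrow> f x = g x) \<Longrightarrow> smooth_on S f \<longleftrightarrow> smooth_on S g"
  unfolding smooth_on_def by (simp cong: Ck_on_cong)

lemma smooth_on_const: "open S \<Longrightarrow> smooth_on S (\<lambda>x. c)"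
  unfolding smooth_on_def by (simp add: Ck_on_const)

lemma smooth_on_compose_linear:
  "open S \<Longrightarrow> bounded_linear L \<Longrightarrow> smooth_on S f \<Longrightarrow> smooth_on S (\<lambda>x. L (f x))"
  unfolding smooth_on_def by (simp add: Ck_on_compose_linear)

lemma smooth_on_linear_compose:
  "open S \<Longrightarrow> bounded_linear L \<Longrightarrow> L ` S \<subseteq> T \<Longrightarrow> smooth_on T f \<Longrightarrow> smooth_on S (\<lambda>x. f (L x))"
  unfolding smooth_on_def by (blast intro: Ck_on_linear_compose)

lemma smooth_on_bounded_linear: "open S \<Longrightarrow> bounded_linear L \<Longrightarrow> smooth_on S L"
  unfolding smooth_on_def by (simp add: Ck_on_bounded_linear)

lemma smooth_on_add:
  "open S \<Longrightarrow> smooth_on S f \<Longrightarrow> smooth_on S g \<Longrightarrow> smooth_on S (\<lambda>x. f x + g x)"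
  unfolding smooth_on_def by (simp add: Ck_on_add)

lemma smooth_on_sum:
  "open S \<Longrightarrow> (\<And>i. i \<in> I \<Longrightarrow> smooth_on S (f i)) \<Longrightarrow> smooth_on S (\<lambda>x. \<Sum>i\<in>I. f i x)"
  unfolding smooth_on_def by (simp add: Ck_on_sum)

lemma smooth_on_bounded_bilinear:
  "open S \<Longrightarrow> bounded_bilinear B \<Longrightarrow> smooth_on S f \<Longrightarrow> smooth_on S g \<Longrightarrow>
    smooth_on S (\<lambda>x. B (f x) (g x))"
  unfolding smooth_on_def by (simp add: Ck_on_bounded_bilinear)

lemma smooth_on_mult:
  fixes f g :: "'a::real_normed_vector \<Rightarrow> real"
  shows "open S \<Longrightarrow> smooth_on S f \<Longrightarrow> smooth_on S g \<Longrightarrow> smooth_on S (\<lambda>x. f x * g x)"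
  by (rule smooth_on_bounded_bilinear[OF _ bounded_bilinear_mult])

lemma smooth_on_prod:
  fixes f :: "'i \<Rightarrow> 'a::real_normed_vector \<Rightarrow> real"
  shows "open S \<Longrightarrow> (\<And>i. i \<in> I \<Longrightarrow> smooth_on S (f i)) \<Longrightarrow> smooth_on S (\<lambda>x. \<Prod>i\<in>I. f i x)"
  unfolding smooth_on_def by (simp add: Ck_on_prod)

lemma smooth_on_divide:
  fixes f g :: "'a::real_normed_vector \<Rightarrow> real"
  assumes "open S" "smooth_on S f" "smooth_on S g" "\<And>x. x \<in> S \<Longrightarrow> g x \<noteq> 0"
  shows "smooth_on S (\<lambda>x. f x / g x)"
  unfolding divide_inverse
  by (rule smooth_on_mult[OF assms(1,2)])
    (use assms(3) in \<open>simp add: smooth_on_def Ck_on_inverse[OF assms(1,4)]\<close>)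

lemma smooth_on_Pair:
  assumes "open S" "smooth_on S f" "smooth_on S g"
  shows "smooth_on S (\<lambda>x. (f x, g x))"
proof -
  have "bounded_linear (\<lambda>a. (a, 0))" "bounded_linear (\<lambda>a. (0, a))"
    by (auto intro!: bounded_linear_Pair bounded_linear_zero bounded_linear_ident)
  then have "smooth_on S (\<lambda>x. (f x, 0) + (0, g x))"
    using assms by (intro smooth_on_add smooth_on_compose_linear[where L = "\<lambda>a. (a, 0)"]
        smooth_on_compose_linear[where L = "\<lambda>a. (0, a)"])
  then show ?thesis by simp
qed

lemma smooth_on_vec_lambda:
  fixes f :: "'n::finite \<Rightarrow> 'a::real_normed_vector \<Rightarrow> real"
  assumes "open S" "\<And>i. smooth_on S (f i)"
  shows "smooth_on S (\<lambda>x. \<chi> i. f i x)"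
proof -
  have "smooth_on S (\<lambda>x. \<Sum>i\<in>UNIV. f i x *\<^sub>R axis i (1::real))"
    by (rule smooth_on_sum[OF assms(1)],
        rule smooth_on_compose_linear[OF assms(1) bounded_linear_scaleR_left], rule assms(2))
  moreover have "(\<Sum>i\<in>UNIV. f i x *\<^sub>R axis i (1::real)) = (\<chi> i. f i x)" for x
    using basis_expansion[of "\<chi> i. f i x"] by (simp add: scalar_mult_eq_scaleR)
  ultimately show ?thesis by simp
qed

lemma smooth_on_det:
  fixes f :: "'n::finite \<Rightarrow> 'n \<Rightarrow> 'a::real_normed_vector \<Rightarrow> real"
  assumes "open S" "\<And>i j. smooth_on S (f i j)"
  shows "smooth_on S (\<lambda>x. det (\<chi> i j. f i j x))"
proof -
  have "smooth_on S (\<lambda>x. \<Sum>p\<in>{p. p permutes (UNIV :: 'n set)}.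
      of_int (sign p) * (\<Prod>i\<in>UNIV. f i (p i) x))"
    by (intro smooth_on_sum smooth_on_mult smooth_on_const smooth_on_prod assms)
  then show ?thesis by (simp add: det_def)
qed

section \<open>Families of linear maps and symmetry of second derivatives\<close>

text \<open>Expansion of the argument in the standard basis turns the family into a finite sum of
  products, so differentiability for each fixed vector suffices and no topology on spaces of
  operators enters. Linearity is asked for near \<open>z0\<close> only, since metrics and transition
  maps are controlled on open sets.\<close>

lemma has_derivative_linear_family:
  fixes L :: "'z::real_normed_vector \<Rightarrow> 'e::euclidean_space \<Rightarrow> 'f::real_normed_vector"
  assumes L: "\<forall>\<^sub>F z in nhds z0. linear (L z)"
    and L': "\<And>b. ((\<lambda>z. L z b) has_derivative L' b) (at z0)"
    and u: "(u has_derivative u') (at z0)"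
  shows "((\<lambda>z. L z (u z)) has_derivative (\<lambda>h. L' (u z0) h + L z0 (u' h))) (at z0)"
proof -
  obtain N where N: "open N" "z0 \<in> N" "\<And>z. z \<in> N \<Longrightarrow> linear (L z)"
    using L unfolding eventually_nhds by blast
  have expand: "L z a = (\<Sum>b\<in>Basis. (a \<bullet> b) *\<^sub>R L z b)" if "z \<in> N" for z a
  proof -
    have "L z a = L z (\<Sum>b\<in>Basis. (a \<bullet> b) *\<^sub>R b)" by (simp add: euclidean_representation)
    also have "\<dots> = (\<Sum>b\<in>Basis. (a \<bullet> b) *\<^sub>R L z b)"
      by (simp add: linear_sum[OF N(3)[OF that]] linear_scale[OF N(3)[OF that]])
    finally show ?thesis .
  qed
  have "((\<lambda>z. \<Sum>b\<in>Basis. (u z0 \<bullet> b) *\<^sub>R L z b) has_derivative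
      (\<lambda>h. \<Sum>b\<in>Basis. (u z0 \<bullet> b) *\<^sub>R L' b h)) (at z0)"
    by (auto intro!: derivative_eq_intros L')
  then have "((\<lambda>z. L z (u z0)) has_derivative
      (\<lambda>h. \<Sum>b\<in>Basis. (u z0 \<bullet> b) *\<^sub>R L' b h)) (at z0)"
    by (rule has_derivative_transform_within_open[OF _ N(1,2)]) (rule expand[symmetric])
  \<comment> \<open>\<open>L'\<close> is given vector by vector, with no assumed linearity in the
    vector; uniqueness of the derivative forces the expansion.\<close>
  then have L'_eq: "L' (u z0) = (\<lambda>h. \<Sum>b\<in>Basis. (u z0 \<bullet> b) *\<^sub>R L' b h)"
    using has_derivative_unique L' by blast
  have "((\<lambda>z. \<Sum>b\<in>Basis. (u z \<bullet> b) *\<^sub>R L z b) has_derivative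
      (\<lambda>h. \<Sum>b\<in>Basis. (u z0 \<bullet> b) *\<^sub>R L' b h + (u' h \<bullet> b) *\<^sub>R L z0 b)) (at z0)"
    by (auto intro!: derivative_eq_intros L' u)
  then have "((\<lambda>z. L z (u z)) has_derivative
      (\<lambda>h. \<Sum>b\<in>Basis. (u z0 \<bullet> b) *\<^sub>R L' b h + (u' h \<bullet> b) *\<^sub>R L z0 b)) (at z0)"
    by (rule has_derivative_transform_within_open[OF _ N(1,2)]) (rule expand[symmetric])
  then show ?thesis
    by (simp add: sum.distrib L'_eq flip: expand[OF N(2)])
qed

text \<open>Two applications of the linear case: with the second argument frozen, then to the
  resulting family in the second argument.\<close>

lemma has_derivative_bilinear_family:
  fixes B :: "'z::real_normed_vector \<Rightarrow> 'e::euclidean_space \<Rightarrow> 'k::euclidean_space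
    \<Rightarrow> 'f::real_normed_vector"
  assumes B: "\<forall>\<^sub>F z in nhds z0. bilinear (B z)"
    and B': "\<And>a b. ((\<lambda>z. B z a b) has_derivative B' a b) (at z0)"
    and u: "(u has_derivative u') (at z0)" and v: "(v has_derivative v') (at z0)"
  shows "((\<lambda>z. B z (u z) (v z)) has_derivative
      (\<lambda>h. B' (u z0) (v z0) h + B z0 (u' h) (v z0) + B z0 (u z0) (v' h))) (at z0)"
proof -
  have 1: "((\<lambda>z. B z (u z) b) has_derivative (\<lambda>h. B' (u z0) b h + B z0 (u' h) b)) (at z0)" for b
    by (rule has_derivative_linear_family[where L = "\<lambda>z a. B z a b" and L' = "\<lambda>a. B' a b"])
      (use B B' u in \<open>auto simp: bilinear_def elim: eventually_mono\<close>)
  have "((\<lambda>z. B z (u z) (v z)) has_derivative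
      (\<lambda>h. (B' (u z0) (v z0) h + B z0 (u' h) (v z0)) + B z0 (u z0) (v' h))) (at z0)"
    by (rule has_derivative_linear_family[where L = "\<lambda>z b. B z (u z) b", OF _ 1 v])
      (use B in \<open>auto simp: bilinear_def elim: eventually_mono\<close>)
  then show ?thesis by simp
qed

text \<open>The left-hand side below is symmetric in \<open>u\<close> and \<open>v\<close>, so \<open>h \<rightarrow> 0\<close> gives the symmetry of
  second derivatives.\<close>

lemma second_difference_mean_value:
  fixes f :: "'a::real_normed_vector \<Rightarrow> real"
  assumes "h > 0"
    and seg: "\<And>s t. s \<in> {0..h} \<Longrightarrow> t \<in> {0..h} \<Longrightarrow> x + s *\<^sub>R u + t *\<^sub>R v \<in> S"
    and f: "\<And>y. y \<in> S \<Longrightarrow> (f has_derivative f' y) (at y)"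
    and f': "\<And>y. y \<in> S \<Longrightarrow> ((\<lambda>z. f' z u) has_derivative f'' y) (at y)"
  obtains s t where "s \<in> {0<..<h}" "t \<in> {0<..<h}"
    "f (x + h *\<^sub>R u + h *\<^sub>R v) - f (x + h *\<^sub>R u) - f (x + h *\<^sub>R v) + f x =
      h\<^sup>2 * f'' (x + s *\<^sub>R u + t *\<^sub>R v) v"
proof -
  \<comment> \<open>The first difference in direction \<open>v\<close>. The mean value theorem is
    applied to it along \<open>u\<close>, then to the \<open>u\<close>-derivative along
    \<open>v\<close>.\<close>
  define a where "a = (\<lambda>s. f (x + s *\<^sub>R u + h *\<^sub>R v) - f (x + s *\<^sub>R u))"
  have der_line: "((\<lambda>r. F (z + r *\<^sub>R w)) has_real_derivative F' w) (at r)"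
    if "(F has_derivative F') (at (z + r *\<^sub>R w))" for F :: "'a \<Rightarrow> real" and F' z w r
  proof -
    have "((\<lambda>r. F (z + r *\<^sub>R w)) has_derivative (\<lambda>k. F' (k *\<^sub>R w))) (at r)"
      by (rule has_derivative_compose[where g = F and f = "\<lambda>r. z + r *\<^sub>R w" and x = r, OF _ that])
        (auto intro!: derivative_eq_intros)
    moreover have "(\<lambda>k. F' (k *\<^sub>R w)) = (*) (F' w)"
      using linear_scale[OF has_derivative_linear[OF that]] by (auto simp: mult.commute)
    ultimately show ?thesis by (simp add: has_field_derivative_def)
  qed
  have "(a has_real_derivative (f' (x + s *\<^sub>R u + h *\<^sub>R v) u - f' (x + s *\<^sub>R u) u)) (at s)"
    if "0 \<le> s" "s \<le> h" for s
  proof -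
    have 0: "x + s *\<^sub>R u \<in> S" and 1: "(x + h *\<^sub>R v) + s *\<^sub>R u \<in> S"
      using seg[of s 0] seg[of s h] that \<open>h > 0\<close> by (auto simp: algebra_simps)
    from DERIV_diff[OF der_line[OF f[OF 1]] der_line[OF f[OF 0]]]
    show ?thesis by (simp add: a_def algebra_simps)
  qed
  from MVT2[OF \<open>h > 0\<close> this] obtain s where s: "0 < s" "s < h"
    "a h - a 0 = h * (f' (x + s *\<^sub>R u + h *\<^sub>R v) u - f' (x + s *\<^sub>R u) u)" by auto
  have "((\<lambda>t. f' (x + s *\<^sub>R u + t *\<^sub>R v) u) has_real_derivative
      f'' (x + s *\<^sub>R u + t *\<^sub>R v) v) (at t)" if "0 \<le> t" "t \<le> h" for t
    by (rule der_line[where F = "\<lambda>z. f' z u"]) (use f' seg s that in auto)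
  from MVT2[OF \<open>h > 0\<close> this] obtain t where t: "0 < t" "t < h"
    "f' (x + s *\<^sub>R u + h *\<^sub>R v) u - f' (x + s *\<^sub>R u) u = h * f'' (x + s *\<^sub>R u + t *\<^sub>R v) v"
    by auto
  show ?thesis
    using that[of s t] s t by (simp add: a_def power2_eq_square algebra_simps)
qed

lemma symmetric_second_derivative_real:
  fixes f :: "'a::real_normed_vector \<Rightarrow> real"
  assumes "open S" "x \<in> S" "Ck_on 2 S f"
  shows "frechet_derivative (\<lambda>y. frechet_derivative f (at y) u) (at x) v =
         frechet_derivative (\<lambda>y. frechet_derivative f (at y) v) (at x) u"
proof -
  have C: "Ck_on (Suc (Suc 0)) S f" using assms(3) by (simp add: numeral_2_eq_2)
  define D where "D = (\<lambda>u v x. frechet_derivative (\<lambda>y. frechet_derivative f (at y) u) (at x) v)"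
  have f: "(f has_derivative frechet_derivative f (at y)) (at y)" if "y \<in> S" for y
    using Ck_on_SucD(1)[OF C that] .
  have f': "((\<lambda>z. frechet_derivative f (at z) w) has_derivative (\<lambda>h. D w h y)) (at y)"
    if "y \<in> S" for y w
    unfolding D_def using Ck_on_SucD(1)[OF Ck_on_SucD(2)[OF C] that] .
  have cont: "continuous_on S (D w w')" for w w'
    using Ck_on_SucD(2)[OF Ck_on_SucD(2)[OF C]] by (simp add: D_def)
  show ?thesis
  proof (rule ccontr)
    assume ne: "\<not> ?thesis"
    \<comment> \<open>Half the gap: if each mixed derivative moves by less than \<open>e\<close> and
      the moved values coincide, the gap is less than \<open>2 * e\<close>, a contradiction.\<close>
    define e where "e = \<bar>D u v x - D v u x\<bar> / 2"
    have e: "e > 0" using ne by (simp add: e_def D_def)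
    have "isCont (D w w') x" for w w'
      using cont assms(1,2) continuous_on_eq_continuous_at by blast
    then have "(D w w' \<longlongrightarrow> D w w' x) (nhds x)" for w w'
      by (simp add: isCont_def tendsto_nhds_iff)
    then have "\<forall>\<^sub>F y in nhds x. dist (D w w' y) (D w w' x) < e" for w w'
      using e by (simp add: tendstoD)
    then have "\<forall>\<^sub>F y in nhds x. dist (D u v y) (D u v x) < e \<and> dist (D v u y) (D v u x) < e \<and> y \<in> S"
      by (intro eventually_conj eventually_nhds_in_open[OF assms(1,2)])
    then obtain d where d: "d > 0"
      "\<And>y. dist y x < d \<Longrightarrow> dist (D u v y) (D u v x) < e \<and> dist (D v u y) (D v u x) < e \<and> y \<in> S"
      unfolding eventually_nhds_metric by blast
    \<comment> \<open>Small enough to keep the whole parallelogram inside the ball of radius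
      \<open>d\<close>; the summand 1 keeps the denominator positive when \<open>u\<close> and
      \<open>v\<close> vanish.\<close>
    define h where "h = d / (2 * (norm u + norm v + 1))"
    have h: "h > 0" using d(1) by (simp add: h_def add_nonneg_pos)
    have near: "dist (x + s *\<^sub>R u + t *\<^sub>R v) x < d" if "s \<in> {0..h}" "t \<in> {0..h}" for s t
    proof -
      have "dist (x + s *\<^sub>R u + t *\<^sub>R v) x \<le> s * norm u + t * norm v"
        using that norm_triangle_ineq[of "s *\<^sub>R u" "t *\<^sub>R v"] by (simp add: dist_norm add.assoc)
      also have "\<dots> \<le> h * norm u + h * norm v"
        using that by (intro add_mono mult_right_mono) auto
      also have "\<dots> \<le> h * (norm u + norm v + 1)" using h by (simp add: algebra_simps)
      also have "\<dots> = d / 2"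
        using add_nonneg_pos[of "norm u + norm v" 1] by (simp add: h_def field_simps)
      also have "\<dots> < d" using d(1) by simp
      finally show ?thesis .
    qed
    let ?\<Delta> = "f (x + h *\<^sub>R u + h *\<^sub>R v) - f (x + h *\<^sub>R u) - f (x + h *\<^sub>R v) + f x"
    obtain s t where 1: "s \<in> {0<..<h}" "t \<in> {0<..<h}" "?\<Delta> = h\<^sup>2 * D u v (x + s *\<^sub>R u + t *\<^sub>R v)"
      by (rule second_difference_mean_value[OF h _ f f', of x u v]) (use near d(2) in auto)
    obtain s' t' where 2: "s' \<in> {0<..<h}" "t' \<in> {0<..<h}"
      "f (x + h *\<^sub>R v + h *\<^sub>R u) - f (x + h *\<^sub>R v) - f (x + h *\<^sub>R u) + f x =
        h\<^sup>2 * D v u (x + s' *\<^sub>R v + t' *\<^sub>R u)"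
      by (rule second_difference_mean_value[OF h _ f f', of x v u])
        (use near d(2) in \<open>auto simp: add.assoc add.commute[of "_ *\<^sub>R v" "_ *\<^sub>R u"]\<close>)
    \<comment> \<open>Both sides are the same second difference divided by \<open>h\<^sup>2\<close>;
      in the second instance \<open>u\<close> and \<open>v\<close> were exchanged, so
      \<open>s'\<close> goes with \<open>v\<close> and \<open>t'\<close> with
      \<open>u\<close>.\<close>
    have "D u v (x + s *\<^sub>R u + t *\<^sub>R v) = D v u (x + t' *\<^sub>R u + s' *\<^sub>R v)"
      using 1(3) 2(3) h by (simp add: algebra_simps)
    moreover have "dist (D u v (x + s *\<^sub>R u + t *\<^sub>R v)) (D u v x) < e"
      using d(2) near 1 by simp
    moreover have "dist (D v u (x + t' *\<^sub>R u + s' *\<^sub>R v)) (D v u x) < e"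
      using d(2) near 2 by simp
    ultimately have "dist (D u v x) (D v u x) < e + e"
      using dist_triangle3[of "D u v x" "D v u x" "D u v (x + s *\<^sub>R u + t *\<^sub>R v)"] by simp
    then show False by (simp add: e_def dist_real_def)
  qed
qed

text \<open>Taking a component is linear and commutes with both differentiations, which reduces the
  claim to real functions.\<close>

lemma symmetric_second_derivative:
  fixes f :: "'a::real_normed_vector \<Rightarrow> 'b::euclidean_space"
  assumes "open S" "x \<in> S" "Ck_on 2 S f"
  shows "frechet_derivative (\<lambda>y. frechet_derivative f (at y) u) (at x) v =
         frechet_derivative (\<lambda>y. frechet_derivative f (at y) v) (at x) u"
proof (rule euclidean_eqI)
  fix b :: 'b assume "b \<in> Basis"
  have C: "Ck_on (Suc (Suc 0)) S f" using assms(3) by (simp add: numeral_2_eq_2)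
  have inner: "frechet_derivative (\<lambda>y. F y \<bullet> b) (at y) = (\<lambda>h. frechet_derivative F (at y) h \<bullet> b)"
    if "(F has_derivative frechet_derivative F (at y)) (at y)" for F :: "'a \<Rightarrow> 'b" and y
    using frechet_derivative_at[OF has_derivative_inner_left[OF that]] by simp
  have two: "frechet_derivative (\<lambda>y. frechet_derivative (\<lambda>y. f y \<bullet> b) (at y) u) (at x) v =
      frechet_derivative (\<lambda>y. frechet_derivative f (at y) u) (at x) v \<bullet> b" for u v
  proof -
    have D: "((\<lambda>y. frechet_derivative f (at y) u) has_derivative
        frechet_derivative (\<lambda>y. frechet_derivative f (at y) u) (at x)) (at x)"
      using Ck_on_SucD(1)[OF Ck_on_SucD(2)[OF C]] assms(2) .
    have "((\<lambda>y. frechet_derivative (\<lambda>y. f y \<bullet> b) (at y) u) has_derivative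
        (\<lambda>h. frechet_derivative (\<lambda>y. frechet_derivative f (at y) u) (at x) h \<bullet> b)) (at x)"
      by (rule has_derivative_transform_within_open[OF has_derivative_inner_left[OF D] assms(1,2)])
        (simp add: inner Ck_on_SucD(1)[OF C])
    then show ?thesis by (simp flip: frechet_derivative_at)
  qed
  have "Ck_on 2 S (\<lambda>y. f y \<bullet> b)"
    by (rule Ck_on_compose_linear[OF assms(1) bounded_linear_inner_left assms(3)])
  from symmetric_second_derivative_real[OF assms(1,2) this, of u v]
  show "frechet_derivative (\<lambda>y. frechet_derivative f (at y) u) (at x) v \<bullet> b =
      frechet_derivative (\<lambda>y. frechet_derivative f (at y) v) (at x) u \<bullet> b"
    by (simp add: two)
qed

section \<open>Riemannian metrics in coordinates\<close>

text \<open>The description in \<open>christoffel\<close> with the coefficient function as the only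
  datum. The calculus of the connection can thus be done without an atlas and applied both to
  \<open>g\<close> on \<open>M\<close> and to the Sasaki coefficients.\<close>

definition christ :: "('e::euclidean_space \<Rightarrow> 'e \<Rightarrow> 'e \<Rightarrow> real) \<Rightarrow> 'e \<Rightarrow> 'e \<Rightarrow> 'e \<Rightarrow> 'e" where
  "christ G x u v =
     (THE z. \<forall>w. G x z w =
        (frechet_derivative (\<lambda>x. G x v w) (at x) u +
         frechet_derivative (\<lambda>x. G x u w) (at x) v -
         frechet_derivative (\<lambda>x. G x u v) (at x) w) / 2)"

lemma christoffel_eq_christ: "christoffel A g c = christ (local_metric A g c)"
  by (intro ext) (simp add: christoffel_def christ_def)

text \<open>Riesz representation in finite dimension: the map \<open>T\<close> sending
  \<open>z\<close> to the Euclidean representative of \<open>B z\<close> is injective by positivity,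
  hence surjective. It supplies the existence behind the \<open>THE\<close> in
  \<open>christ\<close>.\<close>

lemma bilinear_representation:
  fixes B :: "'e::euclidean_space \<Rightarrow> 'e \<Rightarrow> real"
  assumes B: "bilinear B" and pos: "\<And>u. u \<noteq> 0 \<Longrightarrow> B u u > 0" and "linear l"
  obtains z where "\<And>w. B z w = l w"
proof -
  define T where "T = (\<lambda>z. \<Sum>b\<in>Basis. B z b *\<^sub>R b)"
  have T_inner: "T z \<bullet> b = B z b" if "b \<in> Basis" for z b
    using that by (simp add: T_def inner_sum_left_Basis)
  have ext: "B z w = l' w" if "linear l'" "\<And>b. b \<in> Basis \<Longrightarrow> B z b = l' b" for z w l'
    using linear_eq_stdbasis[of "B z" l'] that B by (auto simp: bilinear_def)
  have lin: "linear (\<lambda>z. B z w)" for w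
    using B by (simp add: bilinear_def)
  have "linear T"
    by (rule linearI)
      (auto simp: T_def linear_add[OF lin] linear_scale[OF lin] scaleR_add_left sum.distrib
        scaleR_sum_right)
  moreover have "inj T"
    unfolding linear_injective_0[OF \<open>linear T\<close>]
  proof (intro allI impI)
    fix z assume "T z = 0"
    then have "B z z = 0"
      using ext[of "\<lambda>_. 0" z z] T_inner[of _ z] by (simp add: linear_zero)
    then show "z = 0" using pos by force
  qed
  ultimately obtain z where z: "T z = (\<Sum>b\<in>Basis. l b *\<^sub>R b)"
    by (metis linear_injective_imp_surjective surj_def)
  then have "B z b = l b" if "b \<in> Basis" for b
    using that T_inner[OF that, of z] by (simp add: inner_sum_left_Basis)
  then show thesis using that[of z] ext[OF \<open>linear l\<close>, of z] by blast
qed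

lemma bilinear_Cauchy_Schwarz:
  fixes B :: "'e::real_vector \<Rightarrow> 'e \<Rightarrow> real"
  assumes B: "bilinear B" and sym: "\<And>u v. B u v = B v u" and nonneg: "\<And>u. B u u \<ge> 0"
  shows "B u v \<le> sqrt (B u u) * sqrt (B v v)"
proof -
  have expand: "B (a *\<^sub>R u - b *\<^sub>R v) (a *\<^sub>R u - b *\<^sub>R v) =
      a\<^sup>2 * B u u - 2 * (a * b) * B u v + b\<^sup>2 * B v v"
    for a b
    by (simp add: bilinear_lsub[OF B] bilinear_rsub[OF B] bilinear_lmul[OF B] bilinear_rmul[OF B]
        sym[of v u] power2_eq_square algebra_simps)
  have "(B u v)\<^sup>2 \<le> B u u * B v v"
  proof (cases "B v v = 0")
    case True
    have "B u v = 0"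
    proof (rule ccontr)
      assume ne: "B u v \<noteq> 0"
      \<comment> \<open>For \<open>B v v = 0\<close> the expansion is affine in the coefficient of
        \<open>v\<close>; this coefficient gives it the value \<open>- B u u - 2\<close>, which is
        negative.\<close>
      have "0 \<le> B u u - 2 * ((B u u + 1) / B u v) * B u v"
        using nonneg expand[of 1 "(B u u + 1) / B u v"] True by (metis (no_types, lifting)
            add.right_neutral mult.left_neutral mult_zero_right one_power2)
      then show False using ne nonneg[of u] by simp
    qed
    then show ?thesis using True by simp
  next
    case False
    then have "B v v > 0" using nonneg[of v] by simp
    \<comment> \<open>The form evaluated at \<open>B v v *\<^sub>R u - B u v *\<^sub>R v\<close>,
      which is \<open>B v v\<close> times the component of \<open>u\<close> orthogonal to
      \<open>v\<close>.\<close>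
    moreover have "0 \<le> B v v * (B u u * B v v - (B u v)\<^sup>2)"
      using nonneg[of "B v v *\<^sub>R u - B u v *\<^sub>R v"] unfolding expand
      by (simp add: power2_eq_square algebra_simps)
    ultimately show ?thesis by (simp add: zero_le_mult_iff)
  qed
  then have "\<bar>B u v\<bar> \<le> sqrt (B u u * B v v)"
    by (metis real_sqrt_abs real_sqrt_le_iff)
  then show ?thesis by (simp add: real_sqrt_mult)
qed

text \<open>Plain differentiability is the right regularity: the Sasaki coefficients contain first
  derivatives of \<open>g\<close> through the Christoffel symbols, and must be an instance of the
  same locale.\<close>

locale metric_coeffs =
  fixes S :: "'e::euclidean_space set" and G :: "'e \<Rightarrow> 'e \<Rightarrow> 'e \<Rightarrow> real"
  assumes open_S: "open S"
    and bilinear_G: "x \<in> S \<Longrightarrow> bilinear (G x)"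
    and sym_G: "x \<in> S \<Longrightarrow> G x u v = G x v u"
    and pos_G: "x \<in> S \<Longrightarrow> u \<noteq> 0 \<Longrightarrow> G x u u > 0"
    and differentiable_G: "x \<in> S \<Longrightarrow> (\<lambda>x. G x u v) differentiable (at x)"
begin

definition D :: "'e \<Rightarrow> 'e \<Rightarrow> 'e \<Rightarrow> 'e \<Rightarrow> real" where
  "D x u v = frechet_derivative (\<lambda>x. G x u v) (at x)"

lemma D: "x \<in> S \<Longrightarrow> ((\<lambda>x. G x u v) has_derivative D x u v) (at x)"
  unfolding D_def using differentiable_G frechet_derivative_works by blast

lemma D_unique:
  assumes "x \<in> S" "((\<lambda>x. F x) has_derivative F') (at x)" "\<And>y. y \<in> S \<Longrightarrow> F y = G y u v"
  shows "D x u v = F'"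
  using has_derivative_unique[OF D[OF assms(1)]
      has_derivative_transform_within_open[OF assms(2) open_S assms(1,3)]] .

lemma linear_D: "x \<in> S \<Longrightarrow> linear (D x u v)"
  using D by (rule has_derivative_linear)

lemma D_add: "x \<in> S \<Longrightarrow> D x (u + u') v h = D x u v h + D x u' v h"
  by (subst D_unique[OF _ has_derivative_add[OF D D]])
    (simp_all add: bilinear_ladd[OF bilinear_G])

lemma D_scale: "x \<in> S \<Longrightarrow> D x (r *\<^sub>R u) v h = r * D x u v h"
  by (subst D_unique[OF _ has_derivative_mult_right[OF D]])
    (simp_all add: bilinear_lmul[OF bilinear_G])

lemma D_sym: "x \<in> S \<Longrightarrow> D x u v = D x v u"
  by (rule D_unique[OF _ D]) (simp_all add: sym_G)

lemma D_add_right: "x \<in> S \<Longrightarrow> D x u (v + v') h = D x u v h + D x u v' h"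
  by (simp add: D_add D_sym[of x u])

lemma D_scale_right: "x \<in> S \<Longrightarrow> D x u (r *\<^sub>R v) h = r * D x u v h"
  by (simp add: D_scale D_sym[of x u])

lemma nondegenerate:
  assumes "x \<in> S" "\<And>w. G x z w = G x z' w"
  shows "z = z'"
proof (rule ccontr)
  assume "z \<noteq> z'"
  then have "G x (z - z') (z - z') > 0" using pos_G[OF assms(1)] by simp
  then show False using assms by (simp add: bilinear_lsub[OF bilinear_G])
qed

text \<open>The right-hand side of the Koszul formula is linear in \<open>w\<close>, so it is
  represented by a vector, and nondegeneracy makes this vector unique; the \<open>THE\<close> is
  therefore meaningful.\<close>

lemma christ_eq:
  assumes "x \<in> S"
  shows "G x (christ G x u v) w = (D x v w u + D x u w v - D x u v w) / 2"
proof -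
  have "linear (\<lambda>w. (D x v w u + D x u w v - D x u v w) / 2)"
    by (rule linearI)
      (simp_all add: D_add_right D_scale_right assms linear_add[OF linear_D]
        linear_scale[OF linear_D] field_simps)
  from bilinear_representation[OF bilinear_G[OF assms] pos_G[OF assms] this]
  obtain z where z: "\<And>w. G x z w = (D x v w u + D x u w v - D x u v w) / 2" by blast
  have "\<exists>!z. \<forall>w. G x z w = (D x v w u + D x u w v - D x u v w) / 2"
  proof (rule ex1I[of _ z])
    fix z' assume "\<forall>w. G x z' w = (D x v w u + D x u w v - D x u v w) / 2"
    then show "z' = z" by (intro nondegenerate[OF assms]) (simp add: z)
  qed (use z in blast)
  from theI'[OF this] show ?thesis by (simp add: christ_def flip: D_def)
qed

lemma christ_unique:
  "x \<in> S \<Longrightarrow> (\<And>w. G x z w = (D x v w u + D x u w v - D x u v w) / 2) \<Longrightarrow> christ G x u v = z"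
  by (rule nondegenerate) (auto simp: christ_eq)

lemma christ_sym: "x \<in> S \<Longrightarrow> christ G x u v = christ G x v u"
  by (rule christ_unique) (auto simp: christ_eq D_sym)

lemma bilinear_christ:
  assumes "x \<in> S"
  shows "bilinear (christ G x)"
proof -
  have lin: "linear (\<lambda>u. christ G x u v)" for v
    by (rule linearI; rule christ_unique[OF assms])
      (simp_all add: assms christ_eq bilinear_ladd[OF bilinear_G] bilinear_lmul[OF bilinear_G]
        D_add D_scale linear_add[OF linear_D] linear_scale[OF linear_D] field_simps)
  then have "linear (christ G x u)" for u
    by (subst christ_sym[OF assms, abs_def]) auto
  then show ?thesis using lin by (simp add: bilinear_def)
qed

section \<open>Curves and geodesics in a chart\<close>

lemma has_derivative_G_curve:
  assumes "z s \<in> S" "(z has_vector_derivative z') (at s)"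
    and "(u has_vector_derivative u') (at s)" "(v has_vector_derivative v') (at s)"
  shows "((\<lambda>t. G (z t) (u t) (v t)) has_real_derivative
      D (z s) (u s) (v s) z' + G (z s) u' (v s) + G (z s) (u s) v') (at s)"
proof -
  have "\<forall>\<^sub>F t in nhds s. z t \<in> S"
    using assms(2)[unfolded has_vector_derivative_def] open_S assms(1)
    by (rule has_derivative_eventually_in_open)
  then have "\<forall>\<^sub>F t in nhds s. bilinear (G (z t))"
    by (rule eventually_mono) (rule bilinear_G)
  moreover have "((\<lambda>t. G (z t) a b) has_derivative (\<lambda>h. D (z s) a b (h *\<^sub>R z'))) (at s)" for a b
    using has_derivative_compose[of z "\<lambda>h. h *\<^sub>R z'" s UNIV, OF _ D[OF assms(1), of a b]] assms(2)
    by (simp add: has_vector_derivative_def)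
  ultimately have "((\<lambda>t. G (z t) (u t) (v t)) has_derivative
      (\<lambda>h. D (z s) (u s) (v s) (h *\<^sub>R z') + G (z s) (h *\<^sub>R u') (v s) + G (z s) (u s) (h *\<^sub>R v')))
      (at s)"
    by (rule has_derivative_bilinear_family)
      (use assms(3,4) in \<open>simp_all add: has_vector_derivative_def\<close>)
  then show ?thesis
    unfolding has_field_derivative_def
    by (rule has_derivative_eq_rhs)
      (simp add: fun_eq_iff linear_scale[OF linear_D] assms(1) algebra_simps
        bilinear_lmul[OF bilinear_G] bilinear_rmul[OF bilinear_G])
qed

text \<open>The Euler-Lagrange equation of half the squared speed, in the constant direction
  \<open>w\<close>. In the product rule, the derivative of \<open>G\<close> along the curve cancels
  against one part of the Christoffel term.\<close>

lemma geodesic_momentum: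
  assumes "z s \<in> S" "(z has_vector_derivative z' s) (at s)"
    and "(z' has_vector_derivative z'') (at s)" "z'' + christ G (z s) (z' s) (z' s) = 0"
  shows "((\<lambda>t. G (z t) (z' t) w) has_real_derivative D (z s) (z' s) (z' s) w / 2) (at s)"
proof -
  have "z'' = - christ G (z s) (z' s) (z' s)" using assms(4) by (simp add: eq_neg_iff_add_eq_0)
  then have "G (z s) z'' w = - (D (z s) (z' s) w (z' s)) + D (z s) (z' s) (z' s) w / 2"
    by (simp add: bilinear_lneg[OF bilinear_G] christ_eq assms(1) field_simps)
  then show ?thesis
    using has_derivative_G_curve[OF assms(1-3) has_vector_derivative_const, of w]
    by (simp add: bilinear_rzero[OF bilinear_G] assms(1))
qed

text \<open>The acceleration occurs twice in the product rule, and by the Koszul formula each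
  occurrence contributes minus one half of the derivative of \<open>G\<close> along the
  curve.\<close>

lemma geodesic_energy:
  assumes "z s \<in> S" "(z has_vector_derivative z' s) (at s)"
    and "(z' has_vector_derivative z'') (at s)" "z'' + christ G (z s) (z' s) (z' s) = 0"
  shows "((\<lambda>t. G (z t) (z' t) (z' t)) has_real_derivative 0) (at s)"
proof -
  have "z'' = - christ G (z s) (z' s) (z' s)" using assms(4) by (simp add: eq_neg_iff_add_eq_0)
  then have "G (z s) z'' (z' s) = - (D (z s) (z' s) (z' s) (z' s)) / 2"
    by (simp add: bilinear_lneg[OF bilinear_G] christ_eq assms(1) field_simps)
  then show ?thesis
    using has_derivative_G_curve[OF assms(1-3,3)] sym_G[OF assms(1), of "z' s" z''] by simp
qed

end

text \<open>The Koszul formula tested on the standard basis is a linear system whose matrix is the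
  Gram matrix \<open>M\<close> and whose right-hand side is \<open>b\<close>. Cramer's rule writes
  its solution as a quotient of determinants of smooth functions.\<close>

lemma smooth_on_christ:
  fixes G :: "real ^ 'n \<Rightarrow> real ^ 'n \<Rightarrow> real ^ 'n \<Rightarrow> real"
  assumes "metric_coeffs S G" and smooth: "\<And>u v. smooth_on S (\<lambda>x. G x u v)"
  shows "smooth_on S (\<lambda>x. christ G x u v)"
proof -
  interpret metric_coeffs S G by fact
  define M where "M = (\<lambda>x. \<chi> i j. G x (axis i 1) (axis j 1))"
  define b where "b = (\<lambda>x. \<chi> i. (D x v (axis i 1) u + D x u (axis i 1) v - D x u v (axis i 1)) / 2)"
  have M_mult: "(M x *v z) $ i = G x z (axis i 1)" if "x \<in> S" for x z i
  proof -
    have "G x (axis i 1) z = G x (axis i 1) (\<Sum>j\<in>UNIV. z $ j *\<^sub>R axis j 1)"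
      using basis_expansion[of z] by (simp add: scalar_mult_eq_scaleR)
    also have "\<dots> = (\<Sum>j\<in>UNIV. z $ j * G x (axis i 1) (axis j 1))"
      using bilinear_G[OF that] by (simp add: bilinear_def linear_sum linear_scale)
    finally show ?thesis
      by (simp add: M_def matrix_vector_mult_def sym_G[OF that, of z] mult.commute)
  qed
  have det: "det (M x) \<noteq> 0" if "x \<in> S" for x
  proof -
    \<comment> \<open>A vector in the kernel of the Gram matrix is \<open>G\<close>-orthogonal to
      every basis vector, hence to everything.\<close>
    have "z = 0" if "M x *v z = 0" for z
    proof (rule nondegenerate[OF \<open>x \<in> S\<close>])
      fix w
      have "G x z w = G x z (\<Sum>j\<in>UNIV. w $ j *\<^sub>R axis j 1)"
        using basis_expansion[of w] by (simp add: scalar_mult_eq_scaleR)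
      also have "\<dots> = (\<Sum>j\<in>UNIV. w $ j * G x z (axis j 1))"
        using bilinear_G[OF \<open>x \<in> S\<close>] by (simp add: bilinear_def linear_sum linear_scale)
      also have "\<dots> = 0" using that M_mult[OF \<open>x \<in> S\<close>, of z] by simp
      finally show "G x z w = G x 0 w" by (simp add: bilinear_lzero[OF bilinear_G] \<open>x \<in> S\<close>)
    qed
    then show ?thesis
      by (metis invertible_det_nz invertible_left_inverse matrix_left_invertible_ker)
  qed
  have smooth_D: "smooth_on S (\<lambda>x. D x u v w)" for u v w
    unfolding D_def by (rule smooth_on_frechet_derivative[OF smooth])
  have smooth_b: "smooth_on S (\<lambda>x. b x $ i)" for i
  proof -
    have "smooth_on S (\<lambda>x. (1/2) * ((D x v (axis i 1) u + D x u (axis i 1) v)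
        + (-1) * D x u v (axis i 1)))"
      by (intro smooth_on_mult smooth_on_add smooth_on_const smooth_D open_S)
    then show ?thesis by (simp add: b_def)
  qed
  have smooth_M: "smooth_on S (\<lambda>x. M x $ i $ j)" for i j
    by (simp add: M_def smooth)
  have "christ G x u v = (\<chi> k. det (\<chi> i j. if j = k then b x $ i else M x $ i $ j) / det (M x))"
    if "x \<in> S" for x
  proof -
    have "M x *v christ G x u v = b x"
      by (simp add: vec_eq_iff M_mult that christ_eq b_def)
    then show ?thesis using cramer[OF det[OF that]] by blast
  qed
  moreover have "smooth_on S
      (\<lambda>x. \<chi> k. det (\<chi> i j. if j = k then b x $ i else M x $ i $ j) / det (M x))"
  proof (intro smooth_on_vec_lambda smooth_on_divide open_S det)
    show "smooth_on S (\<lambda>x. det (\<chi> i j. if j = k then b x $ i else M x $ i $ j))" for k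
    proof (rule smooth_on_det[OF open_S])
      show "smooth_on S (\<lambda>x. if j = k then b x $ i else M x $ i $ j)" for i j
        by (cases "j = k") (simp_all add: smooth_b smooth_M)
    qed
    show "smooth_on S (\<lambda>x. det (M x))"
      using smooth_on_det[OF open_S, where f = "\<lambda>i j x. M x $ i $ j", OF smooth_M] by simp
  qed
  ultimately show ?thesis by (rule smooth_on_cong[OF open_S, THEN iffD2])
qed

text \<open>Differentiating the isometry condition \<open>G_eq\<close> once produces the Hessian of
  \<open>\<phi>\<close> in both slots of \<open>G'\<close>; in the Koszul combination all but one of
  these terms disappear by symmetry of the Hessian.\<close>

lemma christ_transform:
  fixes \<phi> :: "'e::euclidean_space \<Rightarrow> 'e"
  assumes "metric_coeffs S G" "metric_coeffs S' G'"
    and T: "open T" "T \<subseteq> S" "\<phi> ` T \<subseteq> S'" and "x \<in> T" and C2: "Ck_on 2 T \<phi>"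
    and G_eq: "\<And>y u v. y \<in> T \<Longrightarrow>
      G y u v = G' (\<phi> y) (frechet_derivative \<phi> (at y) u) (frechet_derivative \<phi> (at y) v)"
    and surj: "surj (frechet_derivative \<phi> (at x))"
  shows "christ G' (\<phi> x) (frechet_derivative \<phi> (at x) u) (frechet_derivative \<phi> (at x) v) =
    frechet_derivative \<phi> (at x) (christ G x u v) -
    frechet_derivative (\<lambda>y. frechet_derivative \<phi> (at y) u) (at x) v"
proof -
  interpret M: metric_coeffs S G by fact
  interpret M': metric_coeffs S' G' by fact
  define d where "d = (\<lambda>y. frechet_derivative \<phi> (at y))"
  define d2 where "d2 = (\<lambda>u. frechet_derivative (\<lambda>y. d y u) (at x))"
  have xS: "x \<in> S" and xS': "\<phi> x \<in> S'" using T \<open>x \<in> T\<close> by auto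
  have C: "Ck_on (Suc (Suc 0)) T \<phi>" using C2 by (simp add: numeral_2_eq_2)
  have d: "(\<phi> has_derivative d x) (at x)"
    unfolding d_def using Ck_on_SucD(1)[OF C \<open>x \<in> T\<close>] .
  have d2: "((\<lambda>y. d y u) has_derivative d2 u) (at x)" for u
    unfolding d2_def d_def using Ck_on_SucD(1)[OF Ck_on_SucD(2)[OF C] \<open>x \<in> T\<close>] .
  have d2_sym: "d2 u v = d2 v u" for u v
    unfolding d2_def d_def by (rule symmetric_second_derivative[OF T(1) \<open>x \<in> T\<close> C2])
  have D_eq: "M.D x u v w =
      M'.D (\<phi> x) (d x u) (d x v) (d x w) + G' (\<phi> x) (d2 u w) (d x v) + G' (\<phi> x) (d x u) (d2 v w)"
    for u v w
  proof -
    have "\<forall>\<^sub>F y in nhds x. \<phi> y \<in> S'"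
      using d M'.open_S xS' by (rule has_derivative_eventually_in_open)
    then have "\<forall>\<^sub>F y in nhds x. bilinear (G' (\<phi> y))"
      by (rule eventually_mono) (rule M'.bilinear_G)
    then have "((\<lambda>y. G' (\<phi> y) (d y u) (d y v)) has_derivative
      (\<lambda>w. M'.D (\<phi> x) (d x u) (d x v) (d x w) + G' (\<phi> x) (d2 u w) (d x v) +
        G' (\<phi> x) (d x u) (d2 v w))) (at x)"
      by (rule has_derivative_bilinear_family[OF _ has_derivative_compose[OF d M'.D[OF xS']] d2 d2])
    then have "((\<lambda>y. G y u v) has_derivative
      (\<lambda>w. M'.D (\<phi> x) (d x u) (d x v) (d x w) + G' (\<phi> x) (d2 u w) (d x v) +
        G' (\<phi> x) (d x u) (d2 v w))) (at x)"
      by (rule has_derivative_transform_within_open[OF _ T(1) \<open>x \<in> T\<close>]) (simp add: G_eq d_def)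
    from has_derivative_unique[OF M.D[OF xS] this] show ?thesis by simp
  qed
  have "christ G' (\<phi> x) (d x u) (d x v) = d x (christ G x u v) - d2 u v"
  proof (rule M'.christ_unique[OF xS'])
    fix w'
    \<comment> \<open>Surjectivity makes the pushed-forward vectors sufficient as test
      vectors.\<close>
    obtain w where w: "w' = d x w" using surj unfolding d_def by (metis surj_def)
    have "G' (\<phi> x) (d x (christ G x u v)) (d x w) = (M.D x v w u + M.D x u w v - M.D x u v w) / 2"
      using M.christ_eq[OF xS] G_eq[OF \<open>x \<in> T\<close>] by (simp add: d_def)
    \<comment> \<open>Of the six Hessian terms, four cancel in pairs and the remaining two coincide,
      which absorbs the factor one half.\<close>
    also have "\<dots> = (M'.D (\<phi> x) (d x v) (d x w) (d x u) + M'.D (\<phi> x) (d x u) (d x w) (d x v) -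
        M'.D (\<phi> x) (d x u) (d x v) (d x w)) / 2 + G' (\<phi> x) (d2 u v) (d x w)"
      unfolding D_eq
      by (simp add: d2_sym[of v u] d2_sym[of w u] d2_sym[of w v]
          M'.sym_G[OF xS', of "d x v" "d2 _ _"] field_simps)
    finally show "G' (\<phi> x) (d x (christ G x u v) - d2 u v) w' =
        (M'.D (\<phi> x) (d x v) w' (d x u) + M'.D (\<phi> x) (d x u) w' (d x v) -
         M'.D (\<phi> x) (d x u) (d x v) w') / 2"
      by (simp add: w bilinear_lsub[OF M'.bilinear_G[OF xS']])
  qed
  then show ?thesis by (simp add: d2_def d_def)
qed

section \<open>The Sasaki metric in coordinates\<close>

text \<open>The connection map of the Levi-Civita connection in coordinates: on the velocity of a
  curve (x, y) it is the covariant derivative of y along x, and its kernel is the horizontal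
  space.\<close>

definition vert_part :: "('e::euclidean_space \<Rightarrow> 'e \<Rightarrow> 'e \<Rightarrow> real) \<Rightarrow> 'e \<times> 'e \<Rightarrow> 'e \<times> 'e \<Rightarrow> 'e" where
  "vert_part G z U = snd U + christ G (fst z) (snd z) (fst U)"

definition sasaki_coeffs ::
    "('e::euclidean_space \<Rightarrow> 'e \<Rightarrow> 'e \<Rightarrow> real) \<Rightarrow> 'e \<times> 'e \<Rightarrow> 'e \<times> 'e \<Rightarrow> 'e \<times> 'e \<Rightarrow> real" where
  "sasaki_coeffs G z U V = G (fst z) (fst U) (fst V) + G (fst z) (vert_part G z U) (vert_part G z V)"

text \<open>Christoffel symbols involve derivatives, so agreement at one point is not enough. This
  transfers them from the invariantly defined local metric of \<open>TM\<close> to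
  \<open>sasaki_coeffs\<close>, which are compared on the chart image only.\<close>

lemma christ_cong:
  assumes "open S" "x \<in> S" "\<And>y. y \<in> S \<Longrightarrow> G y = G' y"
  shows "christ G x = christ G' x"
proof -
  have "frechet_derivative (\<lambda>x. G x u v) (at x) = frechet_derivative (\<lambda>x. G' x u v) (at x)" for u v
    by (rule frechet_derivative_cong_open[OF assms(1,2)]) (simp add: assms(3))
  then show ?thesis
    by (intro ext) (simp add: christ_def assms)
qed

text \<open>Differentiable Christoffel symbols are exactly what makes the vertical part, and with it
  the Sasaki coefficients, differentiable in the base point.\<close>

locale connection_coeffs = metric_coeffs S G
  for S :: "'e::euclidean_space set" and G +
  assumes differentiable_christ: "x \<in> S \<Longrightarrow> (\<lambda>x. christ G x u v) differentiable (at x)"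
begin

abbreviation "vert \<equiv> vert_part G"

abbreviation "sasaki \<equiv> sasaki_coeffs G"

lemma has_derivative_christ:
  assumes "fst z0 \<in> S" "(z has_derivative z') (at t0)" "z t0 = z0"
    "(u has_derivative u') (at t0)" "(v has_derivative v') (at t0)"
  shows "((\<lambda>t. christ G (fst (z t)) (u t) (v t)) has_derivative
    (\<lambda>h. frechet_derivative (\<lambda>x. christ G x (u t0) (v t0)) (at (fst z0)) (fst (z' h)) +
      christ G (fst z0) (u' h) (v t0) + christ G (fst z0) (u t0) (v' h))) (at t0)"
proof -
  have fst_z: "((\<lambda>t. fst (z t)) has_derivative (\<lambda>h. fst (z' h))) (at t0)"
    using assms(2) by (rule has_derivative_fst)
  then have "\<forall>\<^sub>F t in nhds t0. fst (z t) \<in> S"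
    using open_S assms(1,3) has_derivative_eventually_in_open by blast
  then have B: "\<forall>\<^sub>F t in nhds t0. bilinear (christ G (fst (z t)))"
    by (rule eventually_mono) (rule bilinear_christ)
  have "((\<lambda>x. christ G x a b) has_derivative frechet_derivative (\<lambda>x. christ G x a b) (at (fst z0)))
      (at (fst (z t0)))" for a b
    using differentiable_christ[OF assms(1)] assms(3) by (simp add: frechet_derivative_works)
  from has_derivative_bilinear_family[OF B has_derivative_compose[OF fst_z this] assms(4,5)]
  show ?thesis by (simp add: assms(3))
qed

lemma linear_vert: "fst z \<in> S \<Longrightarrow> linear (vert z)"
  by (rule linearI)
    (simp_all add: vert_part_def bilinear_radd[OF bilinear_christ] bilinear_rmul[OF bilinear_christ]
      scaleR_add_right)

lemma vert_differentiable:
  assumes "fst z \<in> S"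
  shows "(\<lambda>z. vert z U) differentiable (at z)"
  unfolding vert_part_def
  by (rule differentiableI,
      rule has_derivative_add[OF has_derivative_const has_derivative_christ[OF assms
        has_derivative_ident refl has_derivative_snd[OF has_derivative_ident] has_derivative_const]])

lemma metric_coeffs_sasaki: "metric_coeffs (S \<times> UNIV) sasaki"
proof
  show "open (S \<times> (UNIV :: 'e set))" by (intro open_Times open_S open_UNIV)
next
  fix z :: "'e \<times> 'e" assume "z \<in> S \<times> UNIV"
  then have z: "fst z \<in> S" by auto
  note add = bilinear_ladd[OF bilinear_G[OF z]] bilinear_radd[OF bilinear_G[OF z]]
    bilinear_lmul[OF bilinear_G[OF z]] bilinear_rmul[OF bilinear_G[OF z]]
    linear_add[OF linear_vert[OF z]] linear_scale[OF linear_vert[OF z]]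
  show "bilinear (sasaki z)"
    unfolding bilinear_def
    by (intro conjI allI linearI) (simp_all add: sasaki_coeffs_def add algebra_simps)
  show "sasaki z U V = sasaki z V U" for U V
    by (simp add: sasaki_coeffs_def sym_G[OF z, of "fst U"] sym_G[OF z, of "vert z U"])
  have nonneg: "G (fst z) u u \<ge> 0" for u
    using pos_G[OF z, of u] by (cases "u = 0") (auto simp: bilinear_lzero[OF bilinear_G[OF z]])
  show "sasaki z U U > 0" if "U \<noteq> 0" for U
  \<comment> \<open>Without a base component the Christoffel term vanishes and the vertical part is
    \<open>snd U\<close>, which is then nonzero.\<close>
  proof (cases "fst U = 0")
    case True
    then have "vert z U \<noteq> 0"
      using that by (simp add: vert_part_def bilinear_rzero[OF bilinear_christ[OF z]] prod_eq_iff)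
    then show ?thesis using pos_G[OF z] nonneg by (simp add: sasaki_coeffs_def add_nonneg_pos)
  next
    case False
    then show ?thesis using pos_G[OF z] nonneg by (simp add: sasaki_coeffs_def add_pos_nonneg)
  qed
  show "(\<lambda>z. sasaki z U V) differentiable (at z)" for U V
  proof -
    have fst: "((\<lambda>z. fst z) has_derivative fst) (at z)"
      using has_derivative_fst[OF has_derivative_ident] .
    then have "\<forall>\<^sub>F z in nhds z. fst z \<in> S"
      using open_S z by (rule has_derivative_eventually_in_open)
    then have B: "\<forall>\<^sub>F z in nhds z. bilinear (G (fst z))"
      by (rule eventually_mono) (rule bilinear_G)
    have "\<And>U. ((\<lambda>z. vert z U) has_derivative frechet_derivative (\<lambda>z. vert z U) (at z)) (at z)"
      using vert_differentiable[OF z] by (simp add: frechet_derivative_works)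
    from has_derivative_add[OF has_derivative_compose[OF fst D[OF z]]
      has_derivative_bilinear_family[OF B has_derivative_compose[OF fst D[OF z]] this this]]
    show ?thesis unfolding sasaki_coeffs_def differentiable_def by blast
  qed
qed

lemma sasaki_vertical_energy:
  assumes "fst (z s) \<in> S" "(z has_vector_derivative z' s) (at s)"
    and "(z' has_vector_derivative z'') (at s)" "z'' + christ sasaki (z s) (z' s) (z' s) = 0"
  shows "((\<lambda>t. G (fst (z t)) (vert (z t) (z' t)) (vert (z t) (z' t))) has_real_derivative 0) (at s)"
proof -
  interpret T: metric_coeffs "S \<times> UNIV" sasaki by (rule metric_coeffs_sasaki)
  have zs: "z s \<in> S \<times> UNIV" using assms(1) by (simp add: mem_Times_iff)
  define Y where "Y = (\<lambda>t. vert (z t) (z' t))"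
  define x where "x = (\<lambda>t. fst (z t))"
  have x: "x s \<in> S" using assms(1) by (simp add: x_def)
  have dx: "(x has_vector_derivative fst (z' s)) (at s)"
    using has_derivative_fst[of z "\<lambda>h. h *\<^sub>R z' s"] assms(2)
    by (simp add: has_vector_derivative_def x_def)
  have "(\<lambda>t. vert (z t) (z' t)) differentiable (at s)"
    unfolding vert_part_def
    by (rule differentiableI, rule has_derivative_add[OF has_derivative_snd has_derivative_christ[OF
          assms(1), of z _ s "\<lambda>t. snd (z t)" _ "\<lambda>t. fst (z' t)",
          OF _ refl has_derivative_snd has_derivative_fst]])
      (use assms(2,3) in \<open>auto simp: has_vector_derivative_def\<close>)
  then obtain Y' where Y': "(Y has_vector_derivative Y') (at s)"
    unfolding Y_def using vector_derivative_works by blast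
  have vert_w: "vert z (0, w) = w" if "fst z \<in> S" for z w
    using that by (simp add: vert_part_def bilinear_rzero[OF bilinear_christ])
  \<comment> \<open>The direction \<open>(0, w)\<close> has no base component and vertical part
    \<open>w\<close>, so \<open>G (x t) (Y t) w\<close> is the momentum conjugate to a fibre
    direction.\<close>
  have sasaki_w: "sasaki (z t) (z' t) (0, w) = G (x t) (Y t) w" if "x t \<in> S" for t w
    using that by (simp add: sasaki_coeffs_def vert_w bilinear_rzero[OF bilinear_G] x_def Y_def)
  \<comment> \<open>Along \<open>(0, w)\<close> the base point is fixed, so the vertical part is
    affine in the step \<open>h\<close> and the coefficients are a quadratic polynomial in
    \<open>h\<close>. The derivative is read off its linear term.\<close>
  have D_vert: "T.D (z s) (z' s) (z' s) (0, w) = 2 * G (x s) (Y s) (christ G (x s) w (fst (z' s)))"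
    for w
  proof -
    let ?k = "christ G (x s) w (fst (z' s))"
    have vert_shift: "vert (z s + h *\<^sub>R (0, w)) (z' s) = Y s + h *\<^sub>R ?k" for h
      using x by (simp add: vert_part_def Y_def x_def bilinear_ladd[OF bilinear_christ]
          bilinear_lmul[OF bilinear_christ])
    have "sasaki (z s + h *\<^sub>R (0, w)) (z' s) (z' s) = G (x s) (fst (z' s)) (fst (z' s)) +
        (G (x s) (Y s) (Y s) + 2 * h * G (x s) (Y s) ?k + h\<^sup>2 * G (x s) ?k ?k)" for h
      unfolding sasaki_coeffs_def vert_shift
      using x sym_G[OF x, of ?k "Y s"]
      by (simp add: x_def bilinear_ladd[OF bilinear_G] bilinear_radd[OF bilinear_G]
          bilinear_lmul[OF bilinear_G] bilinear_rmul[OF bilinear_G] power2_eq_square algebra_simps)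
    then have "((\<lambda>h. sasaki (z s + h *\<^sub>R (0, w)) (z' s) (z' s)) has_real_derivative
        2 * G (x s) (Y s) ?k) (at 0)"
      by (auto intro!: derivative_eq_intros)
    moreover have "((\<lambda>h. sasaki (z s + h *\<^sub>R (0, w)) (z' s) (z' s)) has_real_derivative
        T.D (z s) (z' s) (z' s) (0, w)) (at 0)"
    proof -
      have "((\<lambda>h. z s + h *\<^sub>R (0, w)) has_derivative (\<lambda>h. h *\<^sub>R (0, w))) (at 0)"
        by (auto intro!: derivative_eq_intros)
      moreover have "((\<lambda>z. sasaki z (z' s) (z' s)) has_derivative T.D (z s) (z' s) (z' s))
          (at (z s + 0 *\<^sub>R (0, w)))"
      proof -
        have "z s + 0 *\<^sub>R (0, w) = z s" by (simp add: prod_eq_iff)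
        then show ?thesis using T.D[OF zs] by metis
      qed
      ultimately have "((\<lambda>h. sasaki (z s + h *\<^sub>R (0, w)) (z' s) (z' s)) has_derivative
          (\<lambda>h. T.D (z s) (z' s) (z' s) (h *\<^sub>R (0, w)))) (at 0)"
        by (rule has_derivative_compose)
      then show ?thesis
        unfolding has_field_derivative_def linear_scale[OF T.linear_D[OF zs]]
        by (simp add: mult_commute_abs)
    qed
    ultimately show ?thesis using DERIV_unique by blast
  qed
  have momentum: "((\<lambda>t. G (x t) (Y t) w) has_real_derivative
      G (x s) (Y s) (christ G (x s) w (fst (z' s)))) (at s)" for w
  proof -
    have "\<forall>\<^sub>F t in nhds s. x t \<in> S"
      using dx[unfolded has_vector_derivative_def] open_S x
      by (rule has_derivative_eventually_in_open)
    then have "\<forall>\<^sub>F t in nhds s. sasaki (z t) (z' t) (0, w) = G (x t) (Y t) w"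
      by (rule eventually_mono) (rule sasaki_w)
    then show ?thesis
      using T.geodesic_momentum[OF zs assms(2-4), of "(0, w)"]
      by (simp add: D_vert DERIV_cong_ev)
  qed
  \<comment> \<open>The constant test vector is chosen as \<open>Y s\<close> after differentiation;
    the two expressions for the derivative of the momentum are compared.\<close>
  have "D (x s) (Y s) (Y s) (fst (z' s)) + G (x s) Y' (Y s) =
      G (x s) (Y s) (christ G (x s) (Y s) (fst (z' s)))"
    using DERIV_unique[OF momentum has_derivative_G_curve[OF x dx Y' has_vector_derivative_const]]
    by (simp add: bilinear_rzero[OF bilinear_G[OF x]])
  \<comment> \<open>Compatibility of the connection with the metric: with \<open>Y s\<close> in both
    slots the other two Koszul terms cancel.\<close>
  moreover have "G (x s) (Y s) (christ G (x s) (Y s) (fst (z' s))) =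
      D (x s) (Y s) (Y s) (fst (z' s)) / 2"
    by (simp add: sym_G[OF x, of "Y s"] christ_eq[OF x] D_sym[OF x, of "fst (z' s)"])
  ultimately have "D (x s) (Y s) (Y s) (fst (z' s)) + G (x s) Y' (Y s) + G (x s) (Y s) Y' = 0"
    using sym_G[OF x, of "Y s" Y'] by simp
  then show ?thesis
    using has_derivative_G_curve[OF x dx Y' Y'] by (simp add: x_def Y_def)
qed

end

section \<open>Tangent spaces and the atlas of the tangent bundle\<close>

text \<open>Common ground for \<open>A\<close> and \<open>tangent_atlas A\<close>: tangent vectors
  and velocities use only first derivatives of transition maps, and one derivative of a transition
  of \<open>TM\<close> costs two of the underlying transition of \<open>M\<close>.\<close>

locale differentiable_atlas =
  fixes A :: "('m, 'e::euclidean_space) chart set"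
  assumes inj: "c \<in> A \<Longrightarrow> inj_on (snd c) (fst c)"
    and open_overlap: "c \<in> A \<Longrightarrow> c' \<in> A \<Longrightarrow> open (snd c ` (fst c \<inter> fst c'))"
    and transition_differentiable: "c \<in> A \<Longrightarrow> c' \<in> A \<Longrightarrow> x \<in> snd c ` (fst c \<inter> fst c') \<Longrightarrow>
      transition c c' differentiable (at x)"
begin

abbreviation dtrans :: "('m, 'e) chart \<Rightarrow> ('m, 'e) chart \<Rightarrow> 'm \<Rightarrow> 'e \<Rightarrow> 'e" where
  "dtrans c c' p \<equiv> frechet_derivative (transition c c') (at (snd c p))"

lemma chart_inv_snd [simp]: "c \<in> A \<Longrightarrow> p \<in> fst c \<Longrightarrow> chart_inv c (snd c p) = p"
  by (simp add: chart_inv_def inj)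

lemma transition_snd [simp]:
  "c \<in> A \<Longrightarrow> p \<in> fst c \<Longrightarrow> transition c c' (snd c p) = snd c' p"
  by (simp add: transition_def)

lemma open_chart_image: "c \<in> A \<Longrightarrow> open (chart_image c)"
  using open_overlap[of c c] by simp

lemma has_derivative_transition:
  "c \<in> A \<Longrightarrow> c' \<in> A \<Longrightarrow> p \<in> fst c \<Longrightarrow> p \<in> fst c' \<Longrightarrow>
    (transition c c' has_derivative dtrans c c' p) (at (snd c p))"
  using transition_differentiable[of c c' "snd c p"] by (simp add: frechet_derivative_works)

lemma linear_dtrans:
  "c \<in> A \<Longrightarrow> c' \<in> A \<Longrightarrow> p \<in> fst c \<Longrightarrow> p \<in> fst c' \<Longrightarrow> linear (dtrans c c' p)"
  using has_derivative_transition has_derivative_linear by blast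

lemma dtrans_self:
  assumes "c \<in> A" "p \<in> fst c"
  shows "dtrans c c p = (\<lambda>u. u)"
proof -
  have "(transition c c has_derivative (\<lambda>u. u)) (at (snd c p))"
    by (rule has_derivative_transform_within_open[OF has_derivative_ident open_chart_image[OF assms(1)]])
      (use assms in auto)
  then show ?thesis by (simp flip: frechet_derivative_at)
qed

lemma dtrans_compose:
  assumes "c \<in> A" "c' \<in> A" "c'' \<in> A" "p \<in> fst c" "p \<in> fst c'" "p \<in> fst c''"
  shows "dtrans c' c'' p (dtrans c c' p u) = dtrans c c'' p u"
proof -
  have "(transition c' c'' has_derivative dtrans c' c'' p) (at (transition c c' (snd c p)))"
    using has_derivative_transition[OF assms(2,3,5,6)] assms by simp
  from has_derivative_compose[OF has_derivative_transition[OF assms(1,2,4,5)] this]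
  have "(transition c c'' has_derivative (\<lambda>u. dtrans c' c'' p (dtrans c c' p u))) (at (snd c p))"
  proof (rule has_derivative_transform_within_open)
    show "open (snd c ` (fst c \<inter> fst c') \<inter> snd c ` (fst c \<inter> fst c''))"
      using assms by (intro open_Int open_overlap)
    show "snd c p \<in> snd c ` (fst c \<inter> fst c') \<inter> snd c ` (fst c \<inter> fst c'')"
      using assms by auto
    fix x assume "x \<in> snd c ` (fst c \<inter> fst c') \<inter> snd c ` (fst c \<inter> fst c'')"
    \<comment> \<open>Injectivity of the chart gives one common preimage for the two
      overlaps.\<close>
    then obtain q where "x = snd c q" "q \<in> fst c" "q \<in> fst c'" "q \<in> fst c''"
      using inj[OF assms(1)] by (auto simp: inj_on_eq_iff)
    then show "transition c' c'' (transition c c' x) = transition c c'' x"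
      using assms by simp
  qed
  from frechet_derivative_at[OF this] show ?thesis by metis
qed

lemma surj_dtrans:
  assumes "c \<in> A" "c' \<in> A" "p \<in> fst c" "p \<in> fst c'"
  shows "surj (dtrans c c' p)"
  by (rule surjI[of _ "dtrans c' c p"]) (simp add: assms dtrans_compose dtrans_self)

lemma dtrans_eq_0_iff:
  assumes "c \<in> A" "c' \<in> A" "p \<in> fst c" "p \<in> fst c'"
  shows "dtrans c c' p u = 0 \<longleftrightarrow> u = 0"
  using dtrans_compose[of c c' c p u] assms linear_0[OF linear_dtrans[of c c' p]]
    linear_0[OF linear_dtrans[of c' c p]] by (auto simp: dtrans_self)

lemma tangent_space_dtrans:
  assumes "v \<in> tangent_space A p" "c \<in> A" "c' \<in> A" "p \<in> fst c" "p \<in> fst c'"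
  shows "dtrans c c' p (v c) = v c'"
proof -
  have "\<forall>c\<in>A. \<forall>c'\<in>A. p \<in> fst c \<longrightarrow> p \<in> fst c' \<longrightarrow> v c' = dtrans c c' p (v c)"
    using assms(1) unfolding tangent_space_def mem_Collect_eq by (rule conjunct1)
  from this[rule_format, OF assms(2-5)] show ?thesis by (rule sym)
qed

lemma tangent_space_outside: "v \<in> tangent_space A p \<Longrightarrow> \<not> (c \<in> A \<and> p \<in> fst c) \<Longrightarrow> v c = 0"
  unfolding tangent_space_def by blast

lemma tangent_spaceI:
  assumes "\<And>c c'. c \<in> A \<Longrightarrow> c' \<in> A \<Longrightarrow> p \<in> fst c \<Longrightarrow> p \<in> fst c' \<Longrightarrow> v c' = dtrans c c' p (v c)"
    and "\<And>c. \<not> (c \<in> A \<and> p \<in> fst c) \<Longrightarrow> v c = 0"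
  shows "v \<in> tangent_space A p"
  unfolding tangent_space_def using assms by blast

lemma coord_vec_self [simp]: "c \<in> A \<Longrightarrow> p \<in> fst c \<Longrightarrow> coord_vec A p c u c = u"
  by (simp add: coord_vec_def dtrans_self)

lemma coord_vec_in: "c \<in> A \<Longrightarrow> p \<in> fst c \<Longrightarrow> coord_vec A p c u \<in> tangent_space A p"
  by (rule tangent_spaceI) (auto simp: coord_vec_def dtrans_compose)

text \<open>One component determines a tangent vector: the transformation rule yields those in the
  other charts around \<open>p\<close>, and the remaining values are the default 0.\<close>

lemma tangent_space_eqI:
  assumes "v \<in> tangent_space A p" "w \<in> tangent_space A p" "c \<in> A" "p \<in> fst c" "v c = w c"
  shows "v = w"
proof
  fix c'
  show "v c' = w c'"
    by (metis assms tangent_space_dtrans tangent_space_outside)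
qed

lemma coord_vec_of:
  "v \<in> tangent_space A p \<Longrightarrow> c \<in> A \<Longrightarrow> p \<in> fst c \<Longrightarrow> coord_vec A p c (v c) = v"
  by (rule tangent_space_eqI[OF coord_vec_in]) auto

lemma zero_in_tangent_space: "(\<lambda>_. 0) \<in> tangent_space A p"
  by (rule tangent_spaceI) (simp_all add: linear_0[OF linear_dtrans])

lemma add_in_tangent_space:
  "v \<in> tangent_space A p \<Longrightarrow> w \<in> tangent_space A p \<Longrightarrow> (\<lambda>c. v c + w c) \<in> tangent_space A p"
  by (rule tangent_spaceI)
    (simp_all add: linear_add[OF linear_dtrans] tangent_space_dtrans tangent_space_outside)

lemma chart_at:
  assumes "c \<in> A" "p \<in> fst c"
  shows "chart_at A p \<in> A" "p \<in> fst (chart_at A p)"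
  using someI[of "\<lambda>c. c \<in> A \<and> p \<in> fst c" c] assms by (auto simp: chart_at_def)

lemma smooth_curve_has_vector_derivative:
  assumes "smooth_curve A I \<gamma>" "c \<in> A" "s \<in> I" "\<gamma> s \<in> fst c"
  shows "((\<lambda>t. snd c (\<gamma> t)) has_vector_derivative velocity A \<gamma> s c) (at s)"
    "((\<lambda>t. vector_derivative (snd c \<circ> \<gamma>) (at t)) has_vector_derivative
      vector_derivative (\<lambda>t. vector_derivative (snd c \<circ> \<gamma>) (at t)) (at s)) (at s)"
    "\<forall>\<^sub>F t in nhds s. t \<in> I \<and> \<gamma> t \<in> fst c \<and> velocity A \<gamma> t c = vector_derivative (snd c \<circ> \<gamma>) (at t)"
proof -
  define N where "N = {s \<in> I. \<gamma> s \<in> fst c}"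
  have N: "open N" "s \<in> N" and smooth: "smooth_on N (snd c \<circ> \<gamma>)"
    using assms by (auto simp: smooth_curve_def N_def)
  have vd: "((snd c \<circ> \<gamma>) has_vector_derivative vector_derivative (snd c \<circ> \<gamma>) (at t)) (at t)"
    if "t \<in> N" for t
    using smooth_on_has_derivative[OF smooth that] vector_derivative_works differentiable_def by blast
  show "((\<lambda>t. snd c (\<gamma> t)) has_vector_derivative velocity A \<gamma> s c) (at s)"
    using vd[OF N(2)] assms by (simp add: velocity_def comp_def)
  \<comment> \<open>Smoothness controls Frechet derivatives in a fixed direction; direction 1 on the
    real line gives the vector derivative.\<close>
  have "((\<lambda>t. frechet_derivative (snd c \<circ> \<gamma>) (at t) 1) has_derivative
      frechet_derivative (\<lambda>t. frechet_derivative (snd c \<circ> \<gamma>) (at t) 1) (at s)) (at s)"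
    by (rule smooth_on_has_derivative[OF smooth_on_frechet_derivative[OF smooth] N(2)])
  then have "((\<lambda>t. vector_derivative (snd c \<circ> \<gamma>) (at t)) has_derivative
      frechet_derivative (\<lambda>t. frechet_derivative (snd c \<circ> \<gamma>) (at t) 1) (at s)) (at s)"
  proof (rule has_derivative_transform_within_open[OF _ N])
    fix t assume "t \<in> N"
    from frechet_derivative_at[OF vd[OF this, unfolded has_vector_derivative_def]]
    show "frechet_derivative (snd c \<circ> \<gamma>) (at t) 1 = vector_derivative (snd c \<circ> \<gamma>) (at t)"
      by (metis scaleR_one)
  qed
  then show "((\<lambda>t. vector_derivative (snd c \<circ> \<gamma>) (at t)) has_vector_derivative
      vector_derivative (\<lambda>t. vector_derivative (snd c \<circ> \<gamma>) (at t)) (at s)) (at s)"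
    using vector_derivative_works differentiable_def by blast
  show "\<forall>\<^sub>F t in nhds s. t \<in> I \<and> \<gamma> t \<in> fst c \<and> velocity A \<gamma> t c = vector_derivative (snd c \<circ> \<gamma>) (at t)"
    using eventually_nhds_in_open[OF N]
    by (rule eventually_mono) (simp add: N_def velocity_def \<open>c \<in> A\<close>)
qed

lemma velocity_in_tangent_space:
  assumes "smooth_curve A I \<gamma>" "s \<in> I"
  shows "velocity A \<gamma> s \<in> tangent_space A (\<gamma> s)"
proof -
  have trans: "velocity A \<gamma> s c' = dtrans c c' (\<gamma> s) (velocity A \<gamma> s c)"
    if c: "c \<in> A" "c' \<in> A" "\<gamma> s \<in> fst c" "\<gamma> s \<in> fst c'" for c c'
  proof -
    note vd = smooth_curve_has_vector_derivative[OF assms(1) _ assms(2)]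
    have "((\<lambda>t. transition c c' (snd c (\<gamma> t))) has_derivative
        (\<lambda>h. dtrans c c' (\<gamma> s) (h *\<^sub>R velocity A \<gamma> s c))) (at s)"
      using vd(1)[OF c(1,3)] has_derivative_transition[OF c]
      unfolding has_vector_derivative_def by (rule has_derivative_compose)
    then have "((\<lambda>t. transition c c' (snd c (\<gamma> t))) has_vector_derivative
        dtrans c c' (\<gamma> s) (velocity A \<gamma> s c)) (at s)"
      by (simp add: has_vector_derivative_def linear_scale[OF linear_dtrans[OF c]])
    moreover have "\<forall>\<^sub>F t in nhds s. transition c c' (snd c (\<gamma> t)) = snd c' (\<gamma> t)"
      using vd(3)[OF c(1,3)] by (rule eventually_mono) (simp add: c(1))
    ultimately have "((\<lambda>t. snd c' (\<gamma> t)) has_vector_derivative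
        dtrans c c' (\<gamma> s) (velocity A \<gamma> s c)) (at s)"
      using has_vector_derivative_cong_ev[of UNIV "\<lambda>t. transition c c' (snd c (\<gamma> t))"
        "\<lambda>t. snd c' (\<gamma> t)" s] c by (auto elim: eventually_mono)
    then show ?thesis
      using vd(1)[OF c(2,4)] vector_derivative_unique_at by blast
  qed
  show ?thesis
    by (rule tangent_spaceI[OF trans]) (auto simp: velocity_def)
qed

end

locale manifold_atlas =
  fixes A :: "('m, 'e::euclidean_space) chart set"
  assumes smooth_manifold: "smooth_manifold A"
begin

sublocale M: differentiable_atlas A
proof
  show "inj_on (snd c) (fst c)" if "c \<in> A" for c
    using smooth_manifold that by (simp add: smooth_manifold_def)
  show "open (snd c ` (fst c \<inter> fst c'))" if "c \<in> A" "c' \<in> A" for c c'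
    using smooth_manifold that by (simp add: smooth_manifold_def)
  show "transition c c' differentiable (at x)"
    if "c \<in> A" "c' \<in> A" "x \<in> snd c ` (fst c \<inter> fst c')" for c c' x
    using smooth_manifold that smooth_on_has_derivative
    unfolding smooth_manifold_def differentiable_def by blast
qed

lemma smooth_on_transition:
  "c \<in> A \<Longrightarrow> c' \<in> A \<Longrightarrow> smooth_on (snd c ` (fst c \<inter> fst c')) (transition c c')"
  using smooth_manifold by (simp add: smooth_manifold_def)

text \<open>The Hessian of the transition map. It is the inhomogeneous term both in the change of
  charts on \<open>TM\<close> and in the transformation of Christoffel symbols.\<close>

definition d2trans :: "('m, 'e) chart \<Rightarrow> ('m, 'e) chart \<Rightarrow> 'm \<Rightarrow> 'e \<Rightarrow> 'e \<Rightarrow> 'e" where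
  "d2trans c c' p u =
    frechet_derivative (\<lambda>x. frechet_derivative (transition c c') (at x) u) (at (snd c p))"

lemma has_derivative_d2trans:
  assumes "c \<in> A" "c' \<in> A" "p \<in> fst c" "p \<in> fst c'"
  shows "((\<lambda>x. frechet_derivative (transition c c') (at x) u) has_derivative d2trans c c' p u)
    (at (snd c p))"
  unfolding d2trans_def
  by (rule smooth_on_has_derivative[OF smooth_on_frechet_derivative[OF smooth_on_transition]])
    (use assms in auto)

lemma mem_tangent_chart:
  "q \<in> fst (tangent_chart A c) \<longleftrightarrow> fst q \<in> fst c \<and> snd q \<in> tangent_space A (fst q)"
  by (auto simp: tangent_chart_def)

lemma snd_tangent_chart: "snd (tangent_chart A c) q = (snd c (fst q), snd q c)"
  by (simp add: tangent_chart_def case_prod_beta)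

text \<open>Every vector of the model space is the component of some tangent vector, built by
  \<open>coord_vec\<close>, so the fibres fill the whole second factor.\<close>

lemma tangent_chart_overlap:
  assumes "c \<in> A"
  shows "snd (tangent_chart A c) ` (fst (tangent_chart A c) \<inter> fst (tangent_chart A c')) =
    snd c ` (fst c \<inter> fst c') \<times> UNIV"
proof (intro set_eqI iffI)
  fix z assume "z \<in> snd c ` (fst c \<inter> fst c') \<times> (UNIV :: 'e set)"
  then obtain p where p: "p \<in> fst c" "p \<in> fst c'" "fst z = snd c p" by auto
  then have "z = snd (tangent_chart A c) (p, coord_vec A p c (snd z))"
    using assms by (simp add: snd_tangent_chart prod_eq_iff)
  moreover have "(p, coord_vec A p c (snd z)) \<in> fst (tangent_chart A c) \<inter> fst (tangent_chart A c')"
    using p assms by (simp add: mem_tangent_chart M.coord_vec_in)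
  ultimately show "z \<in> snd (tangent_chart A c) `
      (fst (tangent_chart A c) \<inter> fst (tangent_chart A c'))" by blast
qed (auto simp: snd_tangent_chart mem_tangent_chart)

lemma tangent_chart_image: "c \<in> A \<Longrightarrow> chart_image (tangent_chart A c) = chart_image c \<times> UNIV"
  using tangent_chart_overlap[of c c] by simp

lemma inj_on_tangent_chart:
  assumes "c \<in> A"
  shows "inj_on (snd (tangent_chart A c)) (fst (tangent_chart A c))"
proof (rule inj_onI)
  fix q q' assume *: "q \<in> fst (tangent_chart A c)" "q' \<in> fst (tangent_chart A c)"
    "snd (tangent_chart A c) q = snd (tangent_chart A c) q'"
  then have "fst q = fst q'"
    using M.inj[OF assms] by (auto simp: snd_tangent_chart mem_tangent_chart inj_on_eq_iff)
  moreover have "snd q = snd q'"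
    by (rule M.tangent_space_eqI[of _ "fst q" _ c])
      (use * assms \<open>fst q = fst q'\<close> in \<open>auto simp: snd_tangent_chart mem_tangent_chart\<close>)
  ultimately show "q = q'" by (simp add: prod_eq_iff)
qed

lemma tangent_chart_inv:
  "c \<in> A \<Longrightarrow> q \<in> fst (tangent_chart A c) \<Longrightarrow>
    chart_inv (tangent_chart A c) (snd (tangent_chart A c) q) = q"
  by (simp add: chart_inv_def inj_on_tangent_chart)

text \<open>In coordinates the transition sends (x, y) to the image of x under the base transition
  and of y under its differential at x; differentiating the latter in x brings in the Hessian, in y
  the differential again.\<close>

lemma has_derivative_tangent_transition:
  assumes c: "c \<in> A" "c' \<in> A" "p \<in> fst c" "p \<in> fst c'"
  shows "(transition (tangent_chart A c) (tangent_chart A c') has_derivative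
    (\<lambda>U. (M.dtrans c c' p (fst U), d2trans c c' p y (fst U) + M.dtrans c c' p (snd U))))
    (at (snd c p, y))"
proof -
  let ?\<phi> = "transition c c'" and ?W = "snd c ` (fst c \<inter> fst c')"
  have W: "open ?W" "snd c p \<in> ?W" using c M.open_overlap by auto
  have fst: "(fst has_derivative fst) (at (snd c p, y))"
    using has_derivative_fst[OF has_derivative_ident] .
  then have "\<forall>\<^sub>F z in nhds (snd c p, y). fst z \<in> ?W"
    using W by (intro has_derivative_eventually_in_open) auto
  then have L: "\<forall>\<^sub>F z in nhds (snd c p, y). linear (frechet_derivative ?\<phi> (at (fst z)))"
    by (rule eventually_mono) (use M.linear_dtrans[OF c(1,2)] in auto)
  have "((\<lambda>z. frechet_derivative ?\<phi> (at (fst z)) (snd z)) has_derivative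
      (\<lambda>U. d2trans c c' p y (fst U) + M.dtrans c c' p (snd U))) (at (snd c p, y))"
    using has_derivative_linear_family[OF L has_derivative_compose[OF fst]
        has_derivative_snd[OF has_derivative_ident], of "d2trans c c' p"]
      has_derivative_d2trans[OF c] by simp
  moreover have "((\<lambda>z. ?\<phi> (fst z)) has_derivative (\<lambda>U. M.dtrans c c' p (fst U))) (at (snd c p, y))"
    by (rule has_derivative_compose[OF fst]) (use M.has_derivative_transition[OF c] in simp)
  ultimately have "((\<lambda>z. (?\<phi> (fst z), frechet_derivative ?\<phi> (at (fst z)) (snd z))) has_derivative
      (\<lambda>U. (M.dtrans c c' p (fst U), d2trans c c' p y (fst U) + M.dtrans c c' p (snd U))))
      (at (snd c p, y))"
    by (intro has_derivative_Pair)
  then show ?thesis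
  proof (rule has_derivative_transform_within_open)
    show "open (?W \<times> (UNIV :: 'e set))" by (intro open_Times W open_UNIV)
    show "(snd c p, y) \<in> ?W \<times> UNIV" using W by simp
    fix z assume "z \<in> ?W \<times> (UNIV :: 'e set)"
    then have "z \<in> snd (tangent_chart A c) ` (fst (tangent_chart A c) \<inter> fst (tangent_chart A c'))"
      by (simp add: tangent_chart_overlap[OF c(1)])
    then obtain q where "z = snd (tangent_chart A c) q"
      "q \<in> fst (tangent_chart A c)" "q \<in> fst (tangent_chart A c')" by blast
    moreover from this have "transition (tangent_chart A c) (tangent_chart A c') z =
        snd (tangent_chart A c') q"
      using c(1) by (simp add: transition_def tangent_chart_inv)
    ultimately show "(?\<phi> (fst z), frechet_derivative ?\<phi> (at (fst z)) (snd z)) =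
        transition (tangent_chart A c) (tangent_chart A c') z"
      using c by (simp add: snd_tangent_chart mem_tangent_chart M.tangent_space_dtrans)
  qed
qed

sublocale TM: differentiable_atlas "tangent_atlas A"
proof
  show "inj_on (snd C) (fst C)" if "C \<in> tangent_atlas A" for C
    using that inj_on_tangent_chart by (auto simp: tangent_atlas_def)
  show "open (snd C ` (fst C \<inter> fst C'))" if C: "C \<in> tangent_atlas A" "C' \<in> tangent_atlas A" for C C'
  proof -
    obtain c c' where "c \<in> A" "c' \<in> A" "C = tangent_chart A c" "C' = tangent_chart A c'"
      using C unfolding tangent_atlas_def by blast
    then show ?thesis
      by (simp add: tangent_chart_overlap open_Times M.open_overlap)
  qed
  show "transition C C' differentiable (at z)"
    if C: "C \<in> tangent_atlas A" "C' \<in> tangent_atlas A" and z: "z \<in> snd C ` (fst C \<inter> fst C')" for C C' z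
  proof -
    obtain c c' where c: "c \<in> A" "c' \<in> A" "C = tangent_chart A c" "C' = tangent_chart A c'"
      using C unfolding tangent_atlas_def by blast
    obtain p where "p \<in> fst c" "p \<in> fst c'" "z = (snd c p, snd z)"
      using z unfolding c(3,4) tangent_chart_overlap[OF c(1)] by (auto simp: prod_eq_iff)
    then show ?thesis
      using has_derivative_tangent_transition[OF c(1,2), of p "snd z"] c differentiableI by auto
  qed
qed

lemma tangent_chart_in [simp]: "c \<in> A \<Longrightarrow> tangent_chart A c \<in> tangent_atlas A"
  by (simp add: tangent_atlas_def)

lemma dtrans_tangent:
  assumes "c \<in> A" "c' \<in> A" "fst q \<in> fst c" "fst q \<in> fst c'"
  shows "TM.dtrans (tangent_chart A c) (tangent_chart A c') q U =
    (M.dtrans c c' (fst q) (fst U), d2trans c c' (fst q) (snd q c) (fst U) + M.dtrans c c' (fst q) (snd U))"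
  unfolding snd_tangent_chart
  using fun_cong[OF frechet_derivative_at[OF has_derivative_tangent_transition[OF assms, of "snd q c"]],
      of U] by (rule sym)

lemma tangent_dtrans_fst:
  assumes "\<xi> \<in> tangent_space (tangent_atlas A) q" "c \<in> A" "c' \<in> A"
    and "q \<in> fst (tangent_chart A c)" "q \<in> fst (tangent_chart A c')"
  shows "M.dtrans c c' (fst q) (fst (\<xi> (tangent_chart A c))) = fst (\<xi> (tangent_chart A c'))"
proof -
  have "fst q \<in> fst c" "fst q \<in> fst c'" using assms by (simp_all add: mem_tangent_chart)
  then show ?thesis
    using TM.tangent_space_dtrans[OF assms(1), of "tangent_chart A c" "tangent_chart A c'"] assms
    by (metis dtrans_tangent fst_conv tangent_chart_in)
qed

text \<open>The kernel condition is stated in the chart picked by \<open>chart_at\<close>. Base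
  components change by an invertible linear map, so their vanishing can be tested in any
  chart.\<close>

lemma VTM_iff:
  assumes "c \<in> A" "q \<in> fst (tangent_chart A c)"
  shows "\<xi> \<in> VTM A q \<longleftrightarrow> \<xi> \<in> tangent_space (tangent_atlas A) q \<and> fst (\<xi> (tangent_chart A c)) = 0"
proof -
  define C where "C = chart_at (tangent_atlas A) q"
  have "C \<in> tangent_atlas A" "q \<in> fst C"
    unfolding C_def using TM.chart_at[of "tangent_chart A c" q] assms by auto
  then obtain c0 where c0: "c0 \<in> A" "C = tangent_chart A c0" "q \<in> fst (tangent_chart A c0)"
    by (auto simp: tangent_atlas_def)
  have q: "fst q \<in> fst c" "fst q \<in> fst c0" using assms c0 by (auto simp: mem_tangent_chart)
  have diff: "differential (tangent_atlas A) A fst q \<xi> =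
      (\<lambda>c'. if c' \<in> A \<and> fst q \<in> fst c' then M.dtrans c0 c' (fst q) (fst (\<xi> C)) else 0)"
  proof -
    have "frechet_derivative (snd c' \<circ> fst \<circ> chart_inv C) (at (snd C q)) (\<xi> C) =
        M.dtrans c0 c' (fst q) (fst (\<xi> C))" if c': "c' \<in> A" "fst q \<in> fst c'" for c'
    proof -
      \<comment> \<open>In these charts the bundle projection reads as \<open>fst\<close> followed
        by a transition of \<open>M\<close>.\<close>
      have "((\<lambda>z. transition c0 c' (fst z)) has_derivative (\<lambda>U. M.dtrans c0 c' (fst q) (fst U)))
          (at (snd C q))"
        by (rule has_derivative_compose[OF has_derivative_fst[OF has_derivative_ident]])
          (use M.has_derivative_transition[OF c0(1) c'(1) q(2) c'(2)] in
            \<open>simp add: c0(2) snd_tangent_chart\<close>)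
      then have "((snd c' \<circ> fst \<circ> chart_inv C) has_derivative
          (\<lambda>U. M.dtrans c0 c' (fst q) (fst U))) (at (snd C q))"
      proof (rule has_derivative_transform_within_open)
        show "open (chart_image C)"
          using TM.open_chart_image c0 by simp
        show "snd C q \<in> chart_image C" using c0 by simp
        fix z assume "z \<in> chart_image C"
        then obtain r where "z = snd C r" "r \<in> fst C" by blast
        then show "transition c0 c' (fst z) = (snd c' \<circ> fst \<circ> chart_inv C) z"
          using tangent_chart_inv[OF c0(1), of r] c0(1)
          by (simp add: c0(2)) (simp add: snd_tangent_chart mem_tangent_chart)
      qed
      from fun_cong[OF frechet_derivative_at[OF this]] show ?thesis by (rule sym)
    qed
    then show ?thesis
      unfolding differential_def C_def[symmetric] Let_def by (intro ext) simp
  qed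
  have "differential (tangent_atlas A) A fst q \<xi> = (\<lambda>_. 0) \<longleftrightarrow> fst (\<xi> C) = 0"
  proof
    assume "differential (tangent_atlas A) A fst q \<xi> = (\<lambda>_. 0)"
    from fun_cong[OF this, of c0] show "fst (\<xi> C) = 0"
      using c0(1) q(2) by (simp add: diff M.dtrans_self)
  next
    assume "fst (\<xi> C) = 0"
    then show "differential (tangent_atlas A) A fst q \<xi> = (\<lambda>_. 0)"
      using c0(1) q(2) by (auto simp: diff fun_eq_iff M.dtrans_eq_0_iff)
  qed
  moreover have "fst (\<xi> C) = 0 \<longleftrightarrow> fst (\<xi> (tangent_chart A c)) = 0"
    if "\<xi> \<in> tangent_space (tangent_atlas A) q"
    unfolding c0(2) tangent_dtrans_fst[OF that c0(1) assms(1) c0(3) assms(2), symmetric]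
    using M.dtrans_eq_0_iff[OF c0(1) assms(1) q(2,1)] by simp
  ultimately show ?thesis by (auto simp: VTM_def)
qed

end

section \<open>The Sasaki metric on the tangent bundle\<close>

locale riemannian_atlas =
  fixes A :: "('m, real ^ 'n) chart set" and g :: "('m, real ^ 'n) metric_field"
  assumes riemannian: "riemannian_manifold A g"
begin

sublocale manifold_atlas A
  using riemannian by unfold_locales (simp add: riemannian_manifold_def)

abbreviation "lm c \<equiv> local_metric A g c"

section \<open>The metric and the connection in the charts of the base\<close>

lemma smooth_on_local_metric: "c \<in> A \<Longrightarrow> smooth_on (chart_image c) (\<lambda>x. lm c x u v)"
  using riemannian by (simp add: riemannian_manifold_def riemannian_metric_def)

lemma metric_coeffs_local_metric:
  assumes "c \<in> A"
  shows "metric_coeffs (chart_image c) (lm c)"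
proof
  show "open (chart_image c)" using assms by (rule M.open_chart_image)
  fix x assume x: "x \<in> chart_image c"
  show "bilinear (lm c x)" "\<And>u v. lm c x u v = lm c x v u" "\<And>u. u \<noteq> 0 \<Longrightarrow> lm c x u u > 0"
    using riemannian assms x unfolding riemannian_manifold_def riemannian_metric_def by blast+
  show "(\<lambda>x. lm c x u v) differentiable (at x)" for u v
    using smooth_on_has_derivative[OF smooth_on_local_metric[OF assms] x] differentiableI by blast
qed

lemma smooth_on_local_christ:
  "c \<in> A \<Longrightarrow> smooth_on (chart_image c) (\<lambda>x. christ (lm c) x u v)"
  by (rule smooth_on_christ[OF metric_coeffs_local_metric smooth_on_local_metric])

lemma connection_coeffs_local_metric:
  assumes "c \<in> A"
  shows "connection_coeffs (chart_image c) (lm c)"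
proof -
  interpret metric_coeffs "chart_image c" "lm c" by (rule metric_coeffs_local_metric[OF assms])
  show ?thesis
    by unfold_locales
      (use smooth_on_has_derivative[OF smooth_on_local_christ[OF assms]] differentiableI in blast)
qed

lemma metric_in_chart:
  "c \<in> A \<Longrightarrow> p \<in> fst c \<Longrightarrow> X \<in> tangent_space A p \<Longrightarrow> Y \<in> tangent_space A p \<Longrightarrow>
    g p X Y = lm c (snd c p) (X c) (Y c)"
  by (simp add: local_metric_def M.coord_vec_of Let_def)

lemma local_metric_transform:
  assumes "c \<in> A" "c' \<in> A" "p \<in> fst c" "p \<in> fst c'"
  shows "lm c (snd c p) u v = lm c' (snd c' p) (M.dtrans c c' p u) (M.dtrans c c' p v)"
proof -
  have "coord_vec A p c u c' = M.dtrans c c' p u" for u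
    using assms by (simp add: coord_vec_def)
  then show ?thesis
    using metric_in_chart[OF assms(1,3) M.coord_vec_in[OF assms(1,3)] M.coord_vec_in[OF assms(1,3)], of u v]
      metric_in_chart[OF assms(2,4) M.coord_vec_in[OF assms(1,3)] M.coord_vec_in[OF assms(1,3)], of u v]
      assms by simp
qed

lemma local_christ_transform:
  assumes c: "c \<in> A" "c' \<in> A" "p \<in> fst c" "p \<in> fst c'"
  shows "christ (lm c') (snd c' p) (M.dtrans c c' p u) (M.dtrans c c' p v) =
    M.dtrans c c' p (christ (lm c) (snd c p) u v) - d2trans c c' p u v"
proof -
  let ?T = "snd c ` (fst c \<inter> fst c')"
  have "christ (lm c') (transition c c' (snd c p)) (M.dtrans c c' p u) (M.dtrans c c' p v) =
    M.dtrans c c' p (christ (lm c) (snd c p) u v) - d2trans c c' p u v"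
    unfolding d2trans_def
  proof (rule christ_transform[OF metric_coeffs_local_metric[OF c(1)]
        metric_coeffs_local_metric[OF c(2)] M.open_overlap[OF c(1,2)]])
    show "?T \<subseteq> chart_image c" by blast
    show "transition c c' ` ?T \<subseteq> chart_image c'" using c by auto
    show "snd c p \<in> ?T" using c by blast
    show "Ck_on 2 ?T (transition c c')" by (rule smooth_on_Ck[OF smooth_on_transition[OF c(1,2)]])
    show "surj (M.dtrans c c' p)" by (rule M.surj_dtrans[OF c])
    fix y u v assume "y \<in> ?T"
    then obtain r where "y = snd c r" "r \<in> fst c" "r \<in> fst c'" by blast
    then show "lm c y u v = lm c' (transition c c' y) (frechet_derivative (transition c c') (at y) u)
        (frechet_derivative (transition c c') (at y) v)"
      using local_metric_transform[OF c(1,2), of r] c by simp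
  qed
  then show ?thesis using c by simp
qed

abbreviation "vp c q \<xi> \<equiv> vert_part (lm c) (snd (tangent_chart A c) q) (\<xi> (tangent_chart A c))"

text \<open>The Hessian term in the transformation of \<xi> cancels the one in the transformation of
  the Christoffel symbols, so the vertical part changes like a tangent vector to \<open>M\<close>.
  All chart independence of the horizontal structure comes from here.\<close>

lemma tangent_dtrans_vert:
  assumes "\<xi> \<in> tangent_space (tangent_atlas A) q" "c \<in> A" "c' \<in> A"
    and "q \<in> fst (tangent_chart A c)" "q \<in> fst (tangent_chart A c')"
  shows "M.dtrans c c' (fst q) (vp c q \<xi>) = vp c' q \<xi>"
proof -
  have q: "fst q \<in> fst c" "fst q \<in> fst c'" "snd q \<in> tangent_space A (fst q)"
    using assms by (simp_all add: mem_tangent_chart)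
  have "\<xi> (tangent_chart A c') = TM.dtrans (tangent_chart A c) (tangent_chart A c') q (\<xi> (tangent_chart A c))"
    using TM.tangent_space_dtrans[OF assms(1), of "tangent_chart A c" "tangent_chart A c'"] assms by simp
  then have "vp c' q \<xi> =
      d2trans c c' (fst q) (snd q c) (fst (\<xi> (tangent_chart A c))) +
      M.dtrans c c' (fst q) (snd (\<xi> (tangent_chart A c))) +
      christ (lm c') (snd c' (fst q)) (M.dtrans c c' (fst q) (snd q c))
        (M.dtrans c c' (fst q) (fst (\<xi> (tangent_chart A c))))"
    unfolding dtrans_tangent[OF assms(2,3) q(1,2)]
    by (simp add: vert_part_def snd_tangent_chart M.tangent_space_dtrans[OF q(3) assms(2,3) q(1,2)])
  then show ?thesis
    unfolding local_christ_transform[OF assms(2,3) q(1,2)]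
    by (simp add: vert_part_def snd_tangent_chart linear_add[OF M.linear_dtrans[OF assms(2,3) q(1,2)]])
qed

lemma tangent_eqI:
  assumes "\<xi> \<in> tangent_space (tangent_atlas A) q" "\<eta> \<in> tangent_space (tangent_atlas A) q"
    and "c \<in> A" "q \<in> fst (tangent_chart A c)"
    and "fst (\<xi> (tangent_chart A c)) = fst (\<eta> (tangent_chart A c))" "vp c q \<xi> = vp c q \<eta>"
  shows "\<xi> = \<eta>"
  by (rule TM.tangent_space_eqI[OF assms(1,2), of "tangent_chart A c"])
    (use assms(3-6) in \<open>simp_all add: vert_part_def prod_eq_iff\<close>)

text \<open>In the chart chosen by \<open>chart_at\<close> the three claims are immediate; they move
  to \<open>c\<close> because base component and vertical part both transform as tangent vectors to
  \<open>M\<close>.\<close>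

lemma horizontal_lift:
  assumes "X \<in> tangent_space A (fst q)" "c \<in> A" "q \<in> fst (tangent_chart A c)"
  shows "horizontal_lift A g q X \<in> tangent_space (tangent_atlas A) q"
    and "fst (horizontal_lift A g q X (tangent_chart A c)) = X c"
    and "vp c q (horizontal_lift A g q X) = 0"
proof -
  define c0 where "c0 = chart_at A (fst q)"
  have q: "fst q \<in> fst c" "snd q \<in> tangent_space A (fst q)"
    using assms by (simp_all add: mem_tangent_chart)
  have c0: "c0 \<in> A" "fst q \<in> fst c0"
    using M.chart_at[OF assms(2) q(1)] by (simp_all add: c0_def)
  then have q0: "q \<in> fst (tangent_chart A c0)" using q by (simp add: mem_tangent_chart)
  have eq: "horizontal_lift A g q X = coord_vec (tangent_atlas A) q (tangent_chart A c0)
      (X c0, - christ (lm c0) (snd c0 (fst q)) (snd q c0) (X c0))"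
    by (simp add: horizontal_lift_def c0_def Let_def christoffel_eq_christ)
  show in_T: "horizontal_lift A g q X \<in> tangent_space (tangent_atlas A) q"
    unfolding eq by (rule TM.coord_vec_in) (use c0 q0 in simp_all)
  have at_c0: "horizontal_lift A g q X (tangent_chart A c0) =
      (X c0, - christ (lm c0) (snd c0 (fst q)) (snd q c0) (X c0))"
    unfolding eq by (rule TM.coord_vec_self) (use c0 q0 in simp_all)
  show "fst (horizontal_lift A g q X (tangent_chart A c)) = X c"
    using tangent_dtrans_fst[OF in_T c0(1) assms(2) q0 assms(3)]
      M.tangent_space_dtrans[OF assms(1) c0(1) assms(2) c0(2) q(1)] by (simp add: at_c0)
  show "vp c q (horizontal_lift A g q X) = 0"
    using tangent_dtrans_vert[OF in_T c0(1) assms(2) q0 assms(3)]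
      linear_0[OF M.linear_dtrans[OF c0(1) assms(2) c0(2) q(1)]]
    by (simp add: vert_part_def[of "lm c0"] at_c0 snd_tangent_chart)
qed

lemma vertical_lift:
  assumes "Y \<in> tangent_space A (fst q)" "c \<in> A" "q \<in> fst (tangent_chart A c)"
  shows "vertical_lift A q Y \<in> tangent_space (tangent_atlas A) q"
    and "fst (vertical_lift A q Y (tangent_chart A c)) = 0"
    and "vp c q (vertical_lift A q Y) = Y c"
proof -
  define c0 where "c0 = chart_at A (fst q)"
  have q: "fst q \<in> fst c" "snd q \<in> tangent_space A (fst q)"
    using assms by (simp_all add: mem_tangent_chart)
  have c0: "c0 \<in> A" "fst q \<in> fst c0"
    using M.chart_at[OF assms(2) q(1)] by (simp_all add: c0_def)
  then have q0: "q \<in> fst (tangent_chart A c0)" using q by (simp add: mem_tangent_chart)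
  have eq: "vertical_lift A q Y = coord_vec (tangent_atlas A) q (tangent_chart A c0) (0, Y c0)"
    by (simp add: vertical_lift_def c0_def Let_def)
  show in_T: "vertical_lift A q Y \<in> tangent_space (tangent_atlas A) q"
    unfolding eq by (rule TM.coord_vec_in) (use c0 q0 in simp_all)
  have at_c0: "vertical_lift A q Y (tangent_chart A c0) = (0, Y c0)"
    unfolding eq by (rule TM.coord_vec_self) (use c0 q0 in simp_all)
  show "fst (vertical_lift A q Y (tangent_chart A c)) = 0"
    using tangent_dtrans_fst[OF in_T c0(1) assms(2) q0 assms(3)]
      linear_0[OF M.linear_dtrans[OF c0(1) assms(2) c0(2) q(1)]] by (simp add: at_c0)
  interpret metric_coeffs "chart_image c0" "lm c0" by (rule metric_coeffs_local_metric[OF c0(1)])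
  have "vp c0 q (vertical_lift A q Y) = Y c0"
    unfolding vert_part_def at_c0
    using bilinear_rzero[OF bilinear_christ] c0(2) by (simp add: snd_tangent_chart)
  then show "vp c q (vertical_lift A q Y) = Y c"
    using tangent_dtrans_vert[OF in_T c0(1) assms(2) q0 assms(3)]
      M.tangent_space_dtrans[OF assms(1) c0(1) assms(2) c0(2) q(1)] by simp
qed

lemma linear_vp:
  assumes "c \<in> A" "q \<in> fst (tangent_chart A c)"
  shows "linear (vert_part (lm c) (snd (tangent_chart A c) q))"
proof -
  interpret connection_coeffs "chart_image c" "lm c"
    by (rule connection_coeffs_local_metric[OF assms(1)])
  show ?thesis
    by (rule linear_vert) (use assms(2) in \<open>simp add: snd_tangent_chart mem_tangent_chart\<close>)
qed

text \<open>A horizontal lift has zero vertical part and a vertical lift zero base component. By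
  linearity these two components of \<xi> recover the summands and show that they are unique, which
  resolves the \<open>THE\<close>.\<close>

lemma lift_components_eq:
  assumes "\<xi> \<in> tangent_space (tangent_atlas A) q" "c \<in> A" "q \<in> fst (tangent_chart A c)"
  shows "lift_components A g q \<xi> =
    (coord_vec A (fst q) c (fst (\<xi> (tangent_chart A c))), coord_vec A (fst q) c (vp c q \<xi>))"
    (is "_ = (?X, ?Y)")
proof -
  let ?T = "tangent_space A (fst q)"
  have q: "fst q \<in> fst c" using assms(3) by (simp add: mem_tangent_chart)
  have sum: "fst (\<zeta> (tangent_chart A c)) = X c" "vp c q \<zeta> = Y c"
      "\<zeta> \<in> tangent_space (tangent_atlas A) q"
    if "X \<in> ?T" "Y \<in> ?T" "\<zeta> = (\<lambda>C. horizontal_lift A g q X C + vertical_lift A q Y C)" for X Y \<zeta>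
    using horizontal_lift[OF that(1) assms(2,3)] vertical_lift[OF that(2) assms(2,3)]
      linear_add[OF linear_vp[OF assms(2,3)]] TM.add_in_tangent_space
    by (simp_all add: that(3))
  have XY: "?X \<in> ?T" "?Y \<in> ?T"
    by (intro M.coord_vec_in assms(2) q)+
  show ?thesis
    unfolding lift_components_def
  proof (rule the_equality)
    have "\<xi> = (\<lambda>C. horizontal_lift A g q ?X C + vertical_lift A q ?Y C)"
      by (rule tangent_eqI[OF assms(1) _ assms(2,3)])
        (use sum[OF XY refl] assms(2) q in simp_all)
    then show "case (?X, ?Y) of (X, Y) \<Rightarrow> X \<in> ?T \<and> Y \<in> ?T \<and>
        \<xi> = (\<lambda>C. horizontal_lift A g q X C + vertical_lift A q Y C)"
      using XY by simp
  next
    fix P assume "case P of (X, Y) \<Rightarrow> X \<in> ?T \<and> Y \<in> ?T \<and>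
        \<xi> = (\<lambda>C. horizontal_lift A g q X C + vertical_lift A q Y C)"
    then obtain X Y where P: "P = (X, Y)" "X \<in> ?T" "Y \<in> ?T"
      "\<xi> = (\<lambda>C. horizontal_lift A g q X C + vertical_lift A q Y C)" by auto
    have "X c = fst (\<xi> (tangent_chart A c))" "Y c = vp c q \<xi>"
      using sum(1,2)[OF P(2-4)] by simp_all
    then show "P = (?X, ?Y)"
      using M.coord_vec_of[OF P(2) assms(2) q] M.coord_vec_of[OF P(3) assms(2) q] P(1) by simp
  qed
qed

text \<open>Squared lengths of the two components, defined without a chart so that they can be
  followed along a curve that leaves every single chart.\<close>

definition henergy ::
    "('m, real ^ 'n) tpoint \<Rightarrow> (('m, real ^ 'n) tpoint, (real ^ 'n) \<times> (real ^ 'n)) tvec \<Rightarrow> real" where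
  "henergy q \<xi> = (let X = fst (lift_components A g q \<xi>) in g (fst q) X X)"

definition venergy ::
    "('m, real ^ 'n) tpoint \<Rightarrow> (('m, real ^ 'n) tpoint, (real ^ 'n) \<times> (real ^ 'n)) tvec \<Rightarrow> real" where
  "venergy q \<xi> = (let Y = snd (lift_components A g q \<xi>) in g (fst q) Y Y)"

lemma energy_in_chart:
  assumes "\<xi> \<in> tangent_space (tangent_atlas A) q" "c \<in> A" "q \<in> fst (tangent_chart A c)"
  shows "henergy q \<xi> = lm c (snd c (fst q)) (fst (\<xi> (tangent_chart A c))) (fst (\<xi> (tangent_chart A c)))"
    and "venergy q \<xi> = lm c (snd c (fst q)) (vp c q \<xi>) (vp c q \<xi>)"
proof -
  have q: "fst q \<in> fst c" using assms(3) by (simp add: mem_tangent_chart)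
  show "henergy q \<xi> = lm c (snd c (fst q)) (fst (\<xi> (tangent_chart A c))) (fst (\<xi> (tangent_chart A c)))"
    "venergy q \<xi> = lm c (snd c (fst q)) (vp c q \<xi>) (vp c q \<xi>)"
    using q assms(2)
    by (simp_all add: henergy_def venergy_def Let_def lift_components_eq[OF assms]
        metric_in_chart[of c] M.coord_vec_in)
qed

lemma sasaki_energy: "sasaki_metric A g q \<xi> \<xi> = henergy q \<xi> + venergy q \<xi>"
  by (simp add: sasaki_metric_def henergy_def venergy_def case_prod_beta Let_def)

lemma sasaki_in_chart:
  assumes "\<xi> \<in> tangent_space (tangent_atlas A) q" "\<eta> \<in> tangent_space (tangent_atlas A) q"
    and "c \<in> A" "q \<in> fst (tangent_chart A c)"
  shows "sasaki_metric A g q \<xi> \<eta> =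
    sasaki_coeffs (lm c) (snd (tangent_chart A c) q) (\<xi> (tangent_chart A c)) (\<eta> (tangent_chart A c))"
proof -
  have q: "fst q \<in> fst c" using assms(4) by (simp add: mem_tangent_chart)
  then show ?thesis
    using assms(3)
    by (simp add: sasaki_metric_def lift_components_eq[OF assms(1,3,4)]
        lift_components_eq[OF assms(2,3,4)] metric_in_chart[of c] M.coord_vec_in sasaki_coeffs_def
        snd_tangent_chart)
qed

lemma metric_coeffs_tangent:
  assumes "c \<in> A"
  shows "metric_coeffs (chart_image (tangent_chart A c)) (sasaki_coeffs (lm c))"
  using connection_coeffs.metric_coeffs_sasaki[OF connection_coeffs_local_metric[OF assms]]
  by (simp add: tangent_chart_image[OF assms])

lemma local_sasaki_metric:
  assumes "c \<in> A" "z \<in> chart_image (tangent_chart A c)"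
  shows "local_metric (tangent_atlas A) (sasaki_metric A g) (tangent_chart A c) z =
    sasaki_coeffs (lm c) z"
proof -
  obtain q where q: "z = snd (tangent_chart A c) q" "q \<in> fst (tangent_chart A c)"
    using assms(2) by blast
  show ?thesis
    using q assms(1)
    by (intro ext) (simp add: local_metric_def Let_def tangent_chart_inv sasaki_in_chart TM.coord_vec_in)
qed

lemma HTM_iff:
  assumes "c \<in> A" "q \<in> fst (tangent_chart A c)"
  shows "\<xi> \<in> HTM A g q \<longleftrightarrow> \<xi> \<in> tangent_space (tangent_atlas A) q \<and> vp c q \<xi> = 0"
proof
  assume "\<xi> \<in> HTM A g q"
  then show "\<xi> \<in> tangent_space (tangent_atlas A) q \<and> vp c q \<xi> = 0"
    using horizontal_lift[OF _ assms] by (auto simp: HTM_def)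
next
  assume *: "\<xi> \<in> tangent_space (tangent_atlas A) q \<and> vp c q \<xi> = 0"
  have q: "fst q \<in> fst c" using assms(2) by (simp add: mem_tangent_chart)
  define X where "X = coord_vec A (fst q) c (fst (\<xi> (tangent_chart A c)))"
  have X: "X \<in> tangent_space A (fst q)" "X c = fst (\<xi> (tangent_chart A c))"
    unfolding X_def using assms(1) q by (simp_all add: M.coord_vec_in)
  have "\<xi> = horizontal_lift A g q X"
    by (rule tangent_eqI[OF _ _ assms])
      (use * horizontal_lift[OF X(1) assms] X(2) in simp_all)
  then show "\<xi> \<in> HTM A g q" using X(1) by (simp add: HTM_def)
qed

lemma local_metric_eq_0_iff:
  assumes "c \<in> A" "p \<in> fst c"
  shows "lm c (snd c p) u u = 0 \<longleftrightarrow> u = 0"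
proof -
  interpret metric_coeffs "chart_image c" "lm c" by (rule metric_coeffs_local_metric[OF assms(1)])
  show ?thesis
    using pos_G[of "snd c p" u] bilinear_lzero[OF bilinear_G, of "snd c p" u] assms(2)
    by (cases "u = 0") auto
qed

lemma tangent_point_chart:
  assumes "q \<in> carrier_of (tangent_atlas A)"
  obtains c where "c \<in> A" "q \<in> fst (tangent_chart A c)"
  using assms unfolding carrier_of_def tangent_atlas_def by blast

text \<open>Positive definiteness turns membership into the vanishing of a chart-free number, the
  quantity conserved along geodesics.\<close>

lemma HTM_energy:
  assumes "q \<in> carrier_of (tangent_atlas A)"
  shows "\<xi> \<in> HTM A g q \<longleftrightarrow> \<xi> \<in> tangent_space (tangent_atlas A) q \<and> venergy q \<xi> = 0"
proof -
  obtain c where c: "c \<in> A" "q \<in> fst (tangent_chart A c)"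
    using assms by (rule tangent_point_chart)
  then have "fst q \<in> fst c" by (simp add: mem_tangent_chart)
  then show ?thesis
    using HTM_iff[OF c] energy_in_chart(2)[OF _ c] local_metric_eq_0_iff[OF c(1)] by auto
qed

lemma VTM_energy:
  assumes "q \<in> carrier_of (tangent_atlas A)"
  shows "\<xi> \<in> VTM A q \<longleftrightarrow> \<xi> \<in> tangent_space (tangent_atlas A) q \<and> henergy q \<xi> = 0"
proof -
  obtain c where c: "c \<in> A" "q \<in> fst (tangent_chart A c)"
    using assms by (rule tangent_point_chart)
  then have "fst q \<in> fst c" by (simp add: mem_tangent_chart)
  then show ?thesis
    using VTM_iff[OF c] energy_in_chart(1)[OF _ c] local_metric_eq_0_iff[OF c(1)] by auto
qed

text \<open>Zero derivative is a local statement and may be checked in any chart around each point;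
  the energies are chart-free, so the local results combine to constancy on the interval.\<close>

lemma geodesic_energies_constant:
  assumes "geodesic (tangent_atlas A) (sasaki_metric A g) I \<gamma>"
  shows "\<exists>a b. \<forall>s\<in>I. henergy (\<gamma> s) (velocity (tangent_atlas A) \<gamma> s) = a \<and>
    venergy (\<gamma> s) (velocity (tangent_atlas A) \<gamma> s) = b"
proof -
  let ?v = "velocity (tangent_atlas A) \<gamma>"
  have I: "open I" "is_interval I" and curve: "smooth_curve (tangent_atlas A) I \<gamma>"
    using assms by (simp_all add: geodesic_def)
  have der: "((\<lambda>s. sasaki_metric A g (\<gamma> s) (?v s) (?v s)) has_real_derivative 0) (at s) \<and>
      ((\<lambda>s. venergy (\<gamma> s) (?v s)) has_real_derivative 0) (at s)" if s: "s \<in> I" for s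
  proof -
    have "\<gamma> s \<in> carrier_of (tangent_atlas A)" using curve s by (auto simp: smooth_curve_def)
    then obtain c where c: "c \<in> A" "\<gamma> s \<in> fst (tangent_chart A c)" by (rule tangent_point_chart)
    define C where "C = tangent_chart A c"
    define z where "z = snd C \<circ> \<gamma>"
    define z' where "z' = (\<lambda>t. vector_derivative z (at t))"
    have C: "C \<in> tangent_atlas A" "\<gamma> s \<in> fst C" using c by (simp_all add: C_def)
    note vd = TM.smooth_curve_has_vector_derivative[OF curve C(1) s C(2)]
    have ev: "\<forall>\<^sub>F t in nhds s. t \<in> I \<and> \<gamma> t \<in> fst C \<and> ?v t C = z' t"
      using vd(3) by (simp add: z'_def z_def)
    then have v_s: "?v s C = z' s" using eventually_nhds_x_imp_x by fast
    have dz: "(z has_vector_derivative z' s) (at s)"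
      using vd(1) by (simp add: v_s z_def comp_def)
    have dz': "(z' has_vector_derivative vector_derivative z' (at s)) (at s)"
      using vd(2) by (simp add: z'_def z_def)
    interpret K: connection_coeffs "chart_image c" "lm c"
      by (rule connection_coeffs_local_metric[OF c(1)])
    interpret S: metric_coeffs "chart_image C" "sasaki_coeffs (lm c)"
      unfolding C_def by (rule metric_coeffs_tangent[OF c(1)])
    have zs: "z s \<in> chart_image C" using C by (simp add: z_def)
    then have fst_zs: "fst (z s) \<in> chart_image c"
      unfolding C_def tangent_chart_image[OF c(1)] by (simp add: mem_Times_iff)
    have "christoffel (tangent_atlas A) (sasaki_metric A g) C (z s) = christ (sasaki_coeffs (lm c)) (z s)"
      unfolding christoffel_eq_christ
      by (rule christ_cong[OF S.open_S zs]) (simp add: C_def local_sasaki_metric c(1))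
    moreover have "vector_derivative z' (at s) +
        christoffel (tangent_atlas A) (sasaki_metric A g) C (z s) (z' s) (z' s) = 0"
      using assms s C unfolding geodesic_def Let_def z'_def z_def by blast
    ultimately have eq: "vector_derivative z' (at s) + christ (sasaki_coeffs (lm c)) (z s) (z' s) (z' s) = 0"
      by simp
    have "\<forall>\<^sub>F t in nhds s. sasaki_metric A g (\<gamma> t) (?v t) (?v t) = sasaki_coeffs (lm c) (z t) (z' t) (z' t)"
      using ev
    proof (rule eventually_mono)
      fix t assume t: "t \<in> I \<and> \<gamma> t \<in> fst C \<and> ?v t C = z' t"
      then have "?v t \<in> tangent_space (tangent_atlas A) (\<gamma> t)"
        using TM.velocity_in_tangent_space[OF curve] by simp
      then show "sasaki_metric A g (\<gamma> t) (?v t) (?v t) = sasaki_coeffs (lm c) (z t) (z' t) (z' t)"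
        using sasaki_in_chart[of "?v t" "\<gamma> t" "?v t" c] t c(1) by (simp add: C_def z_def)
    qed
    then have 1: "((\<lambda>s. sasaki_metric A g (\<gamma> s) (?v s) (?v s)) has_real_derivative 0) (at s)"
      using S.geodesic_energy[of z s z', OF zs dz dz' eq] by (simp add: DERIV_cong_ev)
    have "\<forall>\<^sub>F t in nhds s. venergy (\<gamma> t) (?v t) =
        lm c (fst (z t)) (vert_part (lm c) (z t) (z' t)) (vert_part (lm c) (z t) (z' t))"
      using ev
    proof (rule eventually_mono)
      fix t assume t: "t \<in> I \<and> \<gamma> t \<in> fst C \<and> ?v t C = z' t"
      then have "?v t \<in> tangent_space (tangent_atlas A) (\<gamma> t)"
        using TM.velocity_in_tangent_space[OF curve] by simp
      then show "venergy (\<gamma> t) (?v t) =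
          lm c (fst (z t)) (vert_part (lm c) (z t) (z' t)) (vert_part (lm c) (z t) (z' t))"
        using energy_in_chart(2)[of "?v t" "\<gamma> t" c] t c(1)
        by (simp add: C_def z_def) (simp add: snd_tangent_chart)
    qed
    then have 2: "((\<lambda>s. venergy (\<gamma> s) (?v s)) has_real_derivative 0) (at s)"
      using K.sasaki_vertical_energy[of z s z', OF fst_zs dz dz' eq] by (simp add: DERIV_cong_ev)
    show ?thesis using 1 2 ..
  qed
  have "convex I" using I(2) by (simp add: is_interval_convex)
  have "\<exists>e. \<forall>s\<in>I. sasaki_metric A g (\<gamma> s) (?v s) (?v s) = e"
    using has_field_derivative_zero_constant[OF \<open>convex I\<close>,
        of "\<lambda>s. sasaki_metric A g (\<gamma> s) (?v s) (?v s)"] der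
    by (meson has_field_derivative_at_within)
  moreover have "\<exists>b. \<forall>s\<in>I. venergy (\<gamma> s) (?v s) = b"
    using has_field_derivative_zero_constant[OF \<open>convex I\<close>, of "\<lambda>s. venergy (\<gamma> s) (?v s)"] der
    by (meson has_field_derivative_at_within)
  ultimately obtain e b where
    "\<And>s. s \<in> I \<Longrightarrow> sasaki_metric A g (\<gamma> s) (?v s) (?v s) = e" "\<And>s. s \<in> I \<Longrightarrow> venergy (\<gamma> s) (?v s) = b"
    by blast
  then show ?thesis
    \<comment> \<open>The horizontal energy is the conserved total \<open>e\<close> minus the
      vertical energy \<open>b\<close>.\<close>
    by (intro exI[of _ "e - b"] exI[of _ b]) (simp add: sasaki_energy eq_diff_eq)
qed

section \<open>Angles and isoclinity\<close>

text \<open>\<open>h\<close> is the orthogonal projection of \<xi> to \<open>F\<close>. The cosine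
  of the angle with \<open>w\<close> is the product of \<open>h\<close> with the normalized
  \<open>w\<close>; by Cauchy-Schwarz it is at most the length of \<open>h\<close>, with equality at
  \<open>w = h\<close>, and \<open>arccos\<close> is decreasing.\<close>

lemma subspace_angle_projection:
  fixes F :: "(('m, real ^ 'n) tpoint, (real ^ 'n) \<times> (real ^ 'n)) tvec set"
  assumes c: "c \<in> A" "q \<in> fst (tangent_chart A c)"
    and F: "F \<subseteq> tangent_space (tangent_atlas A) q" "\<exists>w\<in>F. w \<noteq> (\<lambda>_. 0)"
    and \<xi>: "\<xi> \<in> tangent_space (tangent_atlas A) q" "sasaki_metric A g q \<xi> \<xi> = 1"
    and h: "h \<in> F" "\<And>w. w \<in> F \<Longrightarrow> sasaki_metric A g q \<xi> w = sasaki_metric A g q h w"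
  shows "subspace_angle (sasaki_metric A g) q \<xi> F = arccos (sqrt (sasaki_metric A g q h h))"
proof -
  define z where "z = snd (tangent_chart A c) q"
  define B where "B = sasaki_coeffs (lm c) z"
  define a where "a = (\<lambda>\<xi> :: (('m, real ^ 'n) tpoint, (real ^ 'n) \<times> (real ^ 'n)) tvec.
    \<xi> (tangent_chart A c))"
  interpret metric_coeffs "chart_image (tangent_chart A c)" "sasaki_coeffs (lm c)"
    by (rule metric_coeffs_tangent[OF c(1)])
  have z: "z \<in> chart_image (tangent_chart A c)" using c(2) by (simp add: z_def)
  have B: "bilinear B" "\<And>u v. B u v = B v u" "\<And>u. u \<noteq> 0 \<Longrightarrow> B u u > 0"
    unfolding B_def using bilinear_G[OF z] sym_G[OF z] pos_G[OF z] by blast+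
  then have B_nonneg: "B u u \<ge> 0" for u
    by (cases "u = 0") (auto simp: bilinear_lzero less_imp_le)
  have CS: "\<bar>B u v\<bar> \<le> sqrt (B u u) * sqrt (B v v)" for u v
    using bilinear_Cauchy_Schwarz[OF B(1,2) B_nonneg, of u v]
      bilinear_Cauchy_Schwarz[OF B(1,2) B_nonneg, of u "- v"]
    by (simp add: bilinear_rneg[OF B(1)] bilinear_lneg[OF B(1)] abs_le_iff)
  have gs: "sasaki_metric A g q \<eta> \<zeta> = B (a \<eta>) (a \<zeta>)"
    if "\<eta> \<in> tangent_space (tangent_atlas A) q" "\<zeta> \<in> tangent_space (tangent_atlas A) q" for \<eta> \<zeta>
    unfolding B_def z_def a_def by (rule sasaki_in_chart[OF that c])
  have hT: "h \<in> tangent_space (tangent_atlas A) q" using F(1) h(1) by blast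
  have \<xi>1: "B (a \<xi>) (a \<xi>) = 1" using \<xi> gs by simp
  have eq: "B (a \<xi>) (a w) = B (a h) (a w)" if "w \<in> F" for w
    using h(2)[OF that] gs \<xi>(1) hT F(1) that by auto
  \<comment> \<open>A projection of a unit vector has length at most 1; together with the lower
    bound -1 below, this keeps the arguments in the range where \<open>arccos\<close> is
    monotone.\<close>
  have hh: "sqrt (B (a h) (a h)) \<le> 1"
  proof (cases "B (a h) (a h) = 0")
    case False
    then have pos: "sqrt (B (a h) (a h)) > 0" using B_nonneg[of "a h"] by simp
    have "sqrt (B (a h) (a h)) * sqrt (B (a h) (a h)) \<le> 1 * sqrt (B (a h) (a h))"
      using CS[of "a \<xi>" "a h"] eq[OF h(1)] B_nonneg[of "a h"] by (simp add: \<xi>1)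
    then show ?thesis using pos mult_le_cancel_right_pos by blast
  qed simp
  have angle: "vec_angle (sasaki_metric A g) q \<xi> w = arccos (B (a h) (a w) / sqrt (B (a w) (a w)))"
    if "w \<in> F" for w
  proof -
    have "w \<in> tangent_space (tangent_atlas A) q" using F(1) that by blast
    then show ?thesis
      using gs[OF \<xi>(1)] gs[of w w] by (simp add: vec_angle_def \<xi>(2) eq[OF that])
  qed
  have nz: "sqrt (B (a w) (a w)) > 0" if "w \<in> F - {\<lambda>_. 0}" for w
  proof -
    have "a w \<noteq> 0"
      using TM.tangent_space_eqI[of w q "\<lambda>_. 0" "tangent_chart A c"] that F(1) c
        TM.zero_in_tangent_space by (auto simp: a_def)
    then show ?thesis using B(3) by simp
  qed
  have "Inf (vec_angle (sasaki_metric A g) q \<xi> ` (F - {\<lambda>_. 0})) = arccos (sqrt (B (a h) (a h)))"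
  proof (rule cInf_eq_minimum)
    show "arccos (sqrt (B (a h) (a h))) \<in> vec_angle (sasaki_metric A g) q \<xi> ` (F - {\<lambda>_. 0})"
    proof (cases "h = (\<lambda>_. 0)")
      case True
      \<comment> \<open>If the projection vanishes, all angles are right angles, and any nonzero
        vector of \<open>F\<close> attains the infimum.\<close>
      then have "B (a h) u = 0" for u by (simp add: a_def bilinear_lzero[OF B(1)])
      moreover obtain w where "w \<in> F" "w \<noteq> (\<lambda>_. 0)" using F(2) by blast
      ultimately show ?thesis using angle[of w] by (auto intro!: image_eqI[of _ _ w])
    next
      case False
      then have "sqrt (B (a h) (a h)) > 0" using nz h(1) by blast
      then have "B (a h) (a h) / sqrt (B (a h) (a h)) = sqrt (B (a h) (a h))"
        using B_nonneg[of "a h"] by (simp add: real_div_sqrt)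
      then show ?thesis using angle[OF h(1)] h(1) False by (intro image_eqI[of _ _ h]) auto
    qed
  next
    fix t assume "t \<in> vec_angle (sasaki_metric A g) q \<xi> ` (F - {\<lambda>_. 0})"
    then obtain w where w: "w \<in> F - {\<lambda>_. 0}" "t = vec_angle (sasaki_metric A g) q \<xi> w" by blast
    have "- 1 \<le> B (a h) (a w) / sqrt (B (a w) (a w))"
      using CS[of "a \<xi>" "a w"] nz[OF w(1)] eq[of w] w(1) by (simp add: \<xi>1 field_simps abs_le_iff)
    moreover have "B (a h) (a w) / sqrt (B (a w) (a w)) \<le> sqrt (B (a h) (a h))"
      using CS[of "a h" "a w"] nz[OF w(1)] by (simp add: field_simps abs_le_iff)
    ultimately show "arccos (sqrt (B (a h) (a h))) \<le> t"
      using hh angle[of w] w by (simp add: arccos_le_arccos)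
  qed
  then show ?thesis by (simp add: subspace_angle_def gs[OF hT hT])
qed

text \<open>The two lifts are orthogonal for the Sasaki metric, so the projections of \<xi> are the
  lifts of its own components, and their squared lengths are the two energies.\<close>

lemma subspace_angle_lifts:
  assumes q: "q \<in> carrier_of (tangent_atlas A)"
    and \<xi>: "\<xi> \<in> tangent_space (tangent_atlas A) q" "sasaki_metric A g q \<xi> \<xi> = 1"
  shows "subspace_angle (sasaki_metric A g) q \<xi> (HTM A g q) = arccos (sqrt (henergy q \<xi>))"
    and "subspace_angle (sasaki_metric A g) q \<xi> (VTM A q) = arccos (sqrt (venergy q \<xi>))"
proof -
  let ?gs = "sasaki_metric A g q" and ?T = "tangent_space (tangent_atlas A) q"
  obtain c where c: "c \<in> A" "q \<in> fst (tangent_chart A c)" using q by (rule tangent_point_chart)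
  have p: "fst q \<in> fst c" using c(2) by (simp add: mem_tangent_chart)
  interpret metric_coeffs "chart_image c" "lm c" by (rule metric_coeffs_local_metric[OF c(1)])
  have zero: "lm c (snd c (fst q)) 0 v = 0" "lm c (snd c (fst q)) v 0 = 0" for v
    using p bilinear_lzero[OF bilinear_G] bilinear_rzero[OF bilinear_G] by simp_all
  have gs: "?gs \<eta> \<zeta> = lm c (snd c (fst q)) (fst (\<eta> (tangent_chart A c))) (fst (\<zeta> (tangent_chart A c))) +
      lm c (snd c (fst q)) (vp c q \<eta>) (vp c q \<zeta>)" if "\<eta> \<in> ?T" "\<zeta> \<in> ?T" for \<eta> \<zeta>
    using sasaki_in_chart[OF that c] by (simp add: sasaki_coeffs_def snd_tangent_chart)
  \<comment> \<open>Some nonzero tangent vector, \<open>undefined\<close> being an arbitrary index;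
    its lifts show that both distributions are nontrivial.\<close>
  define e where "e = coord_vec A (fst q) c (axis undefined 1)"
  have e: "e \<in> tangent_space A (fst q)" "e c \<noteq> 0"
    using c(1) p by (simp_all add: e_def M.coord_vec_in)
  show "subspace_angle (sasaki_metric A g) q \<xi> (HTM A g q) = arccos (sqrt (henergy q \<xi>))"
  proof -
    define h where "h = horizontal_lift A g q (coord_vec A (fst q) c (fst (\<xi> (tangent_chart A c))))"
    have h: "h \<in> ?T" "fst (h (tangent_chart A c)) = fst (\<xi> (tangent_chart A c))" "vp c q h = 0"
      unfolding h_def using horizontal_lift[OF M.coord_vec_in[OF c(1) p] c] c(1) p by simp_all
    have "subspace_angle (sasaki_metric A g) q \<xi> (HTM A g q) = arccos (sqrt (?gs h h))"
    proof (rule subspace_angle_projection[OF c _ _ \<xi>])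
      show "HTM A g q \<subseteq> ?T" using HTM_iff[OF c] by blast
      show "h \<in> HTM A g q" using h HTM_iff[OF c] by simp
      have "horizontal_lift A g q e \<in> HTM A g q" using e(1) by (simp add: HTM_def)
      moreover have "horizontal_lift A g q e \<noteq> (\<lambda>_. 0)"
        using horizontal_lift(2)[OF e(1) c] e(2) by (metis fst_zero)
      ultimately show "\<exists>w\<in>HTM A g q. w \<noteq> (\<lambda>_. 0)" by blast
      show "?gs \<xi> w = ?gs h w" if "w \<in> HTM A g q" for w
        using that \<xi>(1) h by (simp add: HTM_iff[OF c] gs zero)
    qed
    then show ?thesis
      using h by (simp add: gs zero energy_in_chart[OF \<xi>(1) c])
  qed
  show "subspace_angle (sasaki_metric A g) q \<xi> (VTM A q) = arccos (sqrt (venergy q \<xi>))"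
  proof -
    define h where "h = vertical_lift A q (coord_vec A (fst q) c (vp c q \<xi>))"
    have h: "h \<in> ?T" "fst (h (tangent_chart A c)) = 0" "vp c q h = vp c q \<xi>"
      unfolding h_def using vertical_lift[OF M.coord_vec_in[OF c(1) p] c] c(1) p by simp_all
    have "subspace_angle (sasaki_metric A g) q \<xi> (VTM A q) = arccos (sqrt (?gs h h))"
    proof (rule subspace_angle_projection[OF c _ _ \<xi>])
      show "VTM A q \<subseteq> ?T" using VTM_iff[OF c] by blast
      show "h \<in> VTM A q" using h VTM_iff[OF c] by simp
      have "vertical_lift A q e \<in> VTM A q"
        using vertical_lift[OF e(1) c] by (simp add: VTM_iff[OF c])
      moreover have "vertical_lift A q e \<noteq> (\<lambda>_. 0)"
        using vertical_lift(3)[OF e(1) c] e(2) linear_0[OF linear_vp[OF c]] by metis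
      ultimately show "\<exists>w\<in>VTM A q. w \<noteq> (\<lambda>_. 0)" by blast
      show "?gs \<xi> w = ?gs h w" if "w \<in> VTM A q" for w
        using that \<xi>(1) h by (simp add: VTM_iff[OF c] gs zero)
    qed
    then show ?thesis
      using h by (simp add: gs zero energy_in_chart[OF \<xi>(1) c])
  qed
qed

text \<open>In coordinates each fibre is the image of an injective linear map \<open>L c z\<close>;
  the images of the standard basis vectors form a smooth frame over the entire chart image.\<close>

lemma regular_distribution_frame:
  fixes L :: "('m, real ^ 'n) chart \<Rightarrow> (real ^ 'n) \<times> (real ^ 'n) \<Rightarrow> real ^ 'n \<Rightarrow>
    (real ^ 'n) \<times> (real ^ 'n)"
  assumes F: "\<And>q. q \<in> carrier_of (tangent_atlas A) \<Longrightarrow> F q \<subseteq> tangent_space (tangent_atlas A) q"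
    and L: "\<And>c z. c \<in> A \<Longrightarrow> z \<in> chart_image (tangent_chart A c) \<Longrightarrow> linear (L c z) \<and> inj (L c z)"
    and smooth: "\<And>c u. c \<in> A \<Longrightarrow> smooth_on (chart_image (tangent_chart A c)) (\<lambda>z. L c z u)"
    and image: "\<And>c q. c \<in> A \<Longrightarrow> q \<in> fst (tangent_chart A c) \<Longrightarrow>
      (\<lambda>\<xi>. \<xi> (tangent_chart A c)) ` F q = range (L c (snd (tangent_chart A c) q))"
  shows "regular_distribution (tangent_atlas A) F"
proof -
  \<comment> \<open>An enumeration of the standard basis, since frames are indexed by numbers below
    the rank.\<close>
  obtain b :: "nat \<Rightarrow> real ^ 'n" where b: "bij_betw b {..<DIM(real ^ 'n)} Basis"
    using ex_bij_betw_nat_finite[of "Basis :: (real ^ 'n) set"] by (auto simp: lessThan_atLeast0)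
  have "\<exists>W X. open W \<and> snd C q \<in> W \<and> W \<subseteq> chart_image C \<and>
      (\<forall>i<DIM(real ^ 'n). smooth_on W (X i)) \<and>
      (\<forall>x\<in>W. (\<lambda>\<xi>. \<xi> C) ` F (chart_inv C x) = span ((\<lambda>i. X i x) ` {..<DIM(real ^ 'n)}) \<and>
        dim ((\<lambda>i. X i x) ` {..<DIM(real ^ 'n)}) = DIM(real ^ 'n))"
    if C: "C \<in> tangent_atlas A" and q: "q \<in> fst C" for C q
  proof -
    obtain c where c: "c \<in> A" "C = tangent_chart A c"
      using C unfolding tangent_atlas_def by blast
    have "(\<lambda>\<xi>. \<xi> C) ` F (chart_inv C z) = span ((\<lambda>i. L c z (b i)) ` {..<DIM(real ^ 'n)}) \<and>
        dim ((\<lambda>i. L c z (b i)) ` {..<DIM(real ^ 'n)}) = DIM(real ^ 'n)" if z: "z \<in> chart_image C" for z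
    proof -
      have lin: "linear (L c z)" and inj: "inj (L c z)" using L z c by blast+
      obtain r where r: "z = snd C r" "r \<in> fst C" using z by blast
      have frame: "(\<lambda>i. L c z (b i)) ` {..<DIM(real ^ 'n)} = L c z ` Basis"
        using b by (auto simp: bij_betw_def image_image simp flip: image_image[of "L c z" b])
      have "(\<lambda>\<xi>. \<xi> C) ` F (chart_inv C z) = range (L c z)"
        using image[OF c(1), of r] r c by (simp add: tangent_chart_inv)
      moreover have "span (L c z ` Basis) = range (L c z)"
        by (simp add: linear_span_image[OF lin])
      moreover have "dim (L c z ` (Basis :: (real ^ 'n) set)) = DIM(real ^ 'n)"
        using dim_image_eq[OF lin, of Basis] inj by (simp add: dim_eq_card_independent independent_Basis)
      ultimately show ?thesis unfolding frame by simp
    qed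
    moreover have "open (chart_image C)" by (rule TM.open_chart_image[OF C])
    moreover have "smooth_on (chart_image C) (\<lambda>z. L c z (b i))" for i
      unfolding c(2) by (rule smooth[OF c(1)])
    ultimately show ?thesis
      using q by (intro exI[of _ "chart_image C"] exI[of _ "\<lambda>i z. L c z (b i)"]) auto
  qed
  then show ?thesis
    unfolding regular_distribution_def using F by blast
qed

text \<open>Every vector of the model space is the component of a tangent vector to
  \<open>TM\<close>, so a membership condition on components describes the whole image.\<close>

lemma tangent_component_image:
  assumes c: "c \<in> A" "q \<in> fst (tangent_chart A c)"
    and F: "\<And>\<xi>. \<xi> \<in> F \<longleftrightarrow> \<xi> \<in> tangent_space (tangent_atlas A) q \<and> P (\<xi> (tangent_chart A c))"
  shows "(\<lambda>\<xi>. \<xi> (tangent_chart A c)) ` F = Collect P"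
proof (intro set_eqI iffI)
  fix U assume "U \<in> Collect P"
  then have "coord_vec (tangent_atlas A) q (tangent_chart A c) U \<in> F"
    using c by (simp add: F TM.coord_vec_in)
  then show "U \<in> (\<lambda>\<xi>. \<xi> (tangent_chart A c)) ` F"
    using c by (intro image_eqI[of _ _ "coord_vec (tangent_atlas A) q (tangent_chart A c) U"]) simp_all
qed (auto simp: F)

lemma regular_VTM: "regular_distribution (tangent_atlas A) (VTM A)"
proof (rule regular_distribution_frame[where L = "\<lambda>_ _ u. (0, u)"])
  show "VTM A q \<subseteq> tangent_space (tangent_atlas A) q" for q by (auto simp: VTM_def)
  show "linear (\<lambda>u :: real ^ 'n. (0 :: real ^ 'n, u)) \<and> inj (\<lambda>u :: real ^ 'n. (0 :: real ^ 'n, u))"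
    by (auto intro!: linearI injI)
  show "smooth_on (chart_image (tangent_chart A c)) (\<lambda>z. (0, u))" if "c \<in> A" for c u
    by (rule smooth_on_const) (simp add: TM.open_chart_image that)
  show "(\<lambda>\<xi>. \<xi> (tangent_chart A c)) ` VTM A q = range (\<lambda>u. (0, u))"
    if "c \<in> A" "q \<in> fst (tangent_chart A c)" for c q
    using tangent_component_image[OF that VTM_iff[OF that]] by (auto simp: image_iff prod_eq_iff)
qed

lemma regular_HTM: "regular_distribution (tangent_atlas A) (HTM A g)"
proof (rule regular_distribution_frame[where
      L = "\<lambda>c z u. (u, - christ (lm c) (fst z) (snd z) u)"])
  show "HTM A g q \<subseteq> tangent_space (tangent_atlas A) q" if "q \<in> carrier_of (tangent_atlas A)" for q
    using HTM_energy[OF that] by blast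
next
  fix c z assume c: "c \<in> A" and "z \<in> chart_image (tangent_chart A c)"
  then have z: "fst z \<in> chart_image c" by (auto simp: tangent_chart_image)
  interpret metric_coeffs "chart_image c" "lm c" by (rule metric_coeffs_local_metric[OF c])
  show "linear (\<lambda>u. (u, - christ (lm c) (fst z) (snd z) u)) \<and>
      inj (\<lambda>u. (u, - christ (lm c) (fst z) (snd z) u))"
    by (auto intro!: linearI injI
        simp: bilinear_radd[OF bilinear_christ[OF z]] bilinear_rmul[OF bilinear_christ[OF z]])
next
  fix c and u :: "real ^ 'n" assume c: "c \<in> A"
  interpret metric_coeffs "chart_image c" "lm c" by (rule metric_coeffs_local_metric[OF c])
  let ?W = "chart_image (tangent_chart A c)"
  have W: "open ?W" by (rule TM.open_chart_image) (simp add: c)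
  \<comment> \<open>Smoothness of the Christoffel symbols is known for fixed arguments, whereas the
    fibre coordinate \<open>snd z\<close> varies with the point; basis expansion separates the two
    dependences.\<close>
  have expand: "christ (lm c) (fst z) (snd z) u =
      (\<Sum>b\<in>Basis. (snd z \<bullet> b) *\<^sub>R christ (lm c) (fst z) b u)" if "z \<in> ?W" for z
  proof -
    have "fst z \<in> chart_image c" using that c by (auto simp: tangent_chart_image)
    then have lin: "linear (\<lambda>v. christ (lm c) (fst z) v u)"
      using bilinear_christ by (simp add: bilinear_def)
    have "christ (lm c) (fst z) (snd z) u =
        christ (lm c) (fst z) (\<Sum>b\<in>Basis. (snd z \<bullet> b) *\<^sub>R b) u"
      by (simp add: euclidean_representation)
    also have "\<dots> = (\<Sum>b\<in>Basis. (snd z \<bullet> b) *\<^sub>R christ (lm c) (fst z) b u)"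
      by (simp add: linear_sum[OF lin] linear_scale[OF lin])
    finally show ?thesis .
  qed
  have "smooth_on ?W (\<lambda>z. \<Sum>b\<in>Basis. (snd z \<bullet> b) *\<^sub>R christ (lm c) (fst z) b u)"
  proof (intro smooth_on_sum[OF W] smooth_on_bounded_bilinear[OF W bounded_bilinear_scaleR])
    show "smooth_on ?W (\<lambda>z. snd z \<bullet> b)" for b :: "real ^ 'n"
      by (rule smooth_on_bounded_linear[OF W])
        (rule bounded_linear_compose[OF bounded_linear_inner_left bounded_linear_snd])
    show "smooth_on ?W (\<lambda>z. christ (lm c) (fst z) b u)" for b
      by (rule smooth_on_linear_compose[OF W bounded_linear_fst _ smooth_on_local_christ[OF c]])
        (auto simp: tangent_chart_image c)
  qed
  then have "smooth_on ?W (\<lambda>z. christ (lm c) (fst z) (snd z) u)"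
    using smooth_on_cong[OF W, of "\<lambda>z. christ (lm c) (fst z) (snd z) u", OF expand] by blast
  then show "smooth_on ?W (\<lambda>z. (u, - christ (lm c) (fst z) (snd z) u))"
    by (intro smooth_on_Pair[OF W] smooth_on_const[OF W]
        smooth_on_compose_linear[OF W bounded_linear_minus[OF bounded_linear_ident]])
next
  fix c q assume c: "c \<in> A" "q \<in> fst (tangent_chart A c)"
  show "(\<lambda>\<xi>. \<xi> (tangent_chart A c)) ` HTM A g q = range (\<lambda>u. (u,
      - christ (lm c) (fst (snd (tangent_chart A c) q)) (snd (snd (tangent_chart A c) q)) u))"
    using tangent_component_image[OF c HTM_iff[OF c]]
    by (auto simp: image_iff vert_part_def prod_eq_iff eq_neg_iff_add_eq_0)
qed

text \<open>Anything determined by the two energies is constant along geodesics. Membership enters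
  through \<open>P\<close>, the angle of a unit vector through \<open>\<theta>\<close>, so one
  argument serves both distributions.\<close>

lemma isoclineI:
  assumes reg: "regular_distribution (tangent_atlas A) F"
    and F: "\<And>q \<xi>. q \<in> carrier_of (tangent_atlas A) \<Longrightarrow> \<xi> \<in> tangent_space (tangent_atlas A) q \<Longrightarrow>
      \<xi> \<in> F q \<longleftrightarrow> P (henergy q \<xi>) (venergy q \<xi>)"
    and angle: "\<And>q \<xi>. q \<in> carrier_of (tangent_atlas A) \<Longrightarrow> \<xi> \<in> tangent_space (tangent_atlas A) q \<Longrightarrow>
      sasaki_metric A g q \<xi> \<xi> = 1 \<Longrightarrow>
      subspace_angle (sasaki_metric A g) q \<xi> (F q) = \<theta> (henergy q \<xi>) (venergy q \<xi>)"
  shows "isocline (tangent_atlas A) (sasaki_metric A g) F"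
proof -
  let ?v = "velocity (tangent_atlas A)"
  have "(\<exists>s\<in>I. ?v \<gamma> s \<in> F (\<gamma> s)) \<longrightarrow> (\<forall>s\<in>I. ?v \<gamma> s \<in> F (\<gamma> s))" (is ?geo)
    and "arc_length_param (tangent_atlas A) (sasaki_metric A g) I \<gamma> \<longrightarrow>
      (\<exists>\<theta>. \<forall>s\<in>I. subspace_angle (sasaki_metric A g) (\<gamma> s) (?v \<gamma> s) (F (\<gamma> s)) = \<theta>)" (is ?ang)
    if geo: "geodesic (tangent_atlas A) (sasaki_metric A g) I \<gamma>" for I \<gamma>
  proof -
    obtain a b where ab: "\<And>s. s \<in> I \<Longrightarrow> henergy (\<gamma> s) (?v \<gamma> s) = a \<and> venergy (\<gamma> s) (?v \<gamma> s) = b"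
      using geodesic_energies_constant[OF geo] by blast
    have curve: "smooth_curve (tangent_atlas A) I \<gamma>" using geo by (simp add: geodesic_def)
    have in_T: "\<gamma> s \<in> carrier_of (tangent_atlas A)" "?v \<gamma> s \<in> tangent_space (tangent_atlas A) (\<gamma> s)"
      if "s \<in> I" for s
      using curve that TM.velocity_in_tangent_space[OF curve that] by (auto simp: smooth_curve_def)
    show ?geo using F[OF in_T] ab by simp
    show ?ang using angle[OF in_T] ab by (auto simp: arc_length_param_def)
  qed
  then show ?thesis
    unfolding isocline_def totally_geodesic_def using reg by blast
qed

text \<open>Membership is decided by the vertical energy, the angle by the horizontal one; for
  \<open>VTM\<close> the roles are exchanged.\<close>

lemma isocline_HTM: "isocline (tangent_atlas A) (sasaki_metric A g) (HTM A g)"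
  by (rule isoclineI[where P = "\<lambda>_ b. b = 0" and \<theta> = "\<lambda>a _. arccos (sqrt a)"])
    (simp_all add: regular_HTM HTM_energy subspace_angle_lifts)

lemma isocline_VTM: "isocline (tangent_atlas A) (sasaki_metric A g) (VTM A)"
  by (rule isoclineI[where P = "\<lambda>a _. a = 0" and \<theta> = "\<lambda>_ b. arccos (sqrt b)"])
    (simp_all add: regular_VTM VTM_energy subspace_angle_lifts)

end

theorem proposition3p3:
  fixes A :: "('m, real ^ 'n) chart set" and g :: "('m, real ^ 'n) metric_field"
  assumes "riemannian_manifold A g"
  shows "isocline (tangent_atlas A) (sasaki_metric A g) (HTM A g) \<and>
         isocline (tangent_atlas A) (sasaki_metric A g) (VTM A)"
proof -
  interpret riemannian_atlas A g by (rule riemannian_atlas.intro[OF assms])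
  show ?thesis using isocline_HTM isocline_VTM ..
qed

end
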